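(* Let $(P,\Lambda,F)$ be a regular projective plane of dimension $2n\ge4$. Then the system of first order differential equations for plane curves in $P$ is elliptic.
   Context: A projective plane is a triple $(P,\Lambda,F)$ of a set $P$ of points, a set $\Lambda$ of lines and $F\subset P\times\Lambda$ ($p$ is on $\lambda$ if $(p,\lambda)\in F$) such that any two distinct points are on a unique line $p_1p_2$, any two distinct lines have a unique common point $\lambda_1\lambda_2$, and there are 4 points with no three on a line. It is smooth if $P,\Lambda$ are compact smooth manifolds, $F\subset P\times\Lambda$ is a smooth embedded submanifold, and the maps $(p_1,p_2)\mapsto p_1p_2$, $(\lambda_1,\lambda_2)\mapsto\lambda_1\lambda_2$ are smooth on pairs of distinct elements. Dimension: $\dim P=\dim\Lambda=2n$. $\bar\lambda\subset P$ is the $n$-dimensional submanifold of points on $\lambda$, and $\bar p\subset\Lambda$ the $n$-dimensional submanifold of lines through $p$. The plane is regular if it is smooth and for every $p_0\in P$ and every real line $\ell\subset T_{p_0}P$, the map $\bar p_0\to\widetilde{\mathrm{Gr}}(n,T_{p_0}P)$, $\lambda\mapsto T_{p_0}\bar\lambda$, into the Grassmannian of (oriented) $n$-planes has only transverse intersections (if any) with the submanifold $\widetilde{\mathrm{Gr}}_\ell(n,T_{p_0}P)$ of $n$-planes containing $\ell$. A plane curve is an immersion $C\to P$ of an $n$-manifold tangent to some line $\bar\lambda$ at each point; plane curves are the solutions of the first order differential system given by the image of the Gauss map $F\to\widetilde{\mathrm{Gr}}(n,TP)$, $(p,\lambda)\mapsto T_p\bar\lambda$ (for a regular plane this map is an embedding),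 i.e. the requirement that tangent spaces lie in this image. The system is elliptic if it has no real characteristics: at each $(p,\lambda)\in F$, with $E=T_p\bar\lambda$, the image of $T_\lambda\bar p$ in $T_E\widetilde{\mathrm{Gr}}(n,T_pP)=\mathrm{Hom}(E,T_pP/E)$ (the tableau of the system) contains no linear map of rank $1$. *)

theory Defs
  imports "HOL-Analysis.Analysis"
begin

primrec Ck_on :: "nat \<Rightarrow> ('a::euclidean_space \<Rightarrow> 'b::euclidean_space) \<Rightarrow> 'a set \<Rightarrow> bool" where
  "Ck_on 0 f S \<longleftrightarrow> continuous_on S f"
| "Ck_on (Suc k) f S \<longleftrightarrow>
     (\<forall>x\<in>S. f differentiable (at x)) \<and> (\<forall>v. Ck_on k (\<lambda>x. frechet_derivative f (at x) v) S)"

text \<open>Only meant for open \<open>S\<close>: the derivatives are taken in the full neighbourhood filter.\<close>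

definition smooth_on :: "('a::euclidean_space \<Rightarrow> 'b::euclidean_space) \<Rightarrow> 'a set \<Rightarrow> bool" where
  "smooth_on f S \<longleftrightarrow> (\<forall>k. Ck_on k f S)"

text \<open>
  A manifold is given by its atlas, a set of charts \<open>(U, \<phi>)\<close>. Carrier and topology are
  recovered from the atlas; the dimension is that of the model space \<open>'e\<close>.
\<close>

type_synonym ('a, 'e) chart = "'a set \<times> ('a \<Rightarrow> 'e)"
type_synonym ('a, 'e) atlas = "('a, 'e) chart set"

definition mcarrier :: "('a, 'e) atlas \<Rightarrow> 'a set" where
  "mcarrier M = (\<Union>c\<in>M. fst c)"

definition mtopology :: "('a, 'e::topological_space) atlas \<Rightarrow> 'a topology" where
  "mtopology M = topology_generated_by {{x \<in> U. \<phi> x \<in> V} | U \<phi> V. (U, \<phi>) \<in> M \<and> open V}"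

definition smooth_transition ::
    "('a, 'e::euclidean_space) chart \<Rightarrow> ('a, 'e) chart \<Rightarrow> bool" where
  "smooth_transition c d \<longleftrightarrow>
     open (snd c ` (fst c \<inter> fst d)) \<and>
     smooth_on (snd d \<circ> inv_into (fst c) (snd c)) (snd c ` (fst c \<inter> fst d))"

text \<open>The charts of the maximal atlas determined by \<open>M\<close>.\<close>

definition smooth_chart :: "('a, 'e::euclidean_space) atlas \<Rightarrow> ('a, 'e) chart \<Rightarrow> bool" where
  "smooth_chart M c \<longleftrightarrow>
     fst c \<subseteq> mcarrier M \<and> inj_on (snd c) (fst c) \<and> open (snd c ` fst c) \<and>
     (\<forall>d\<in>M. smooth_transition c d \<and> smooth_transition d c)"

definition smooth_manifold :: "('a, 'e::euclidean_space) atlas \<Rightarrow> bool" where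
  "smooth_manifold M \<longleftrightarrow>
     (\<forall>c\<in>M. smooth_chart M c) \<and>
     Hausdorff_space (mtopology M) \<and> second_countable (mtopology M)"

definition prod_atlas :: "('a, 'e) atlas \<Rightarrow> ('b, 'f) atlas \<Rightarrow> ('a \<times> 'b, 'e \<times> 'f) atlas" where
  "prod_atlas M N = {(U \<times> V, map_prod \<phi> \<psi>) | U \<phi> V \<psi>. (U, \<phi>) \<in> M \<and> (V, \<psi>) \<in> N}"

text \<open>Smoothness on an open subset \<open>W\<close> of \<open>M\<close>.\<close>

definition smooth_map_on ::
    "('a, 'e::euclidean_space) atlas \<Rightarrow> ('b, 'f::euclidean_space) atlas \<Rightarrow>
     'a set \<Rightarrow> ('a \<Rightarrow> 'b) \<Rightarrow> bool" where
  "smooth_map_on M N W f \<longleftrightarrow>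
     continuous_map (subtopology (mtopology M) W) (mtopology N) f \<and>
     (\<forall>(U, \<phi>)\<in>M. \<forall>(V, \<psi>)\<in>N.
        smooth_on (\<psi> \<circ> f \<circ> inv_into U \<phi>) (\<phi> ` {x \<in> U \<inter> W. f x \<in> V}))"

definition embedded_submanifold ::
    "('a, 'e::euclidean_space) atlas \<Rightarrow> nat \<Rightarrow> 'a set \<Rightarrow> bool" where
  "embedded_submanifold M k S \<longleftrightarrow>
     S \<subseteq> mcarrier M \<and>
     (\<forall>x\<in>S. \<exists>U \<phi> K. smooth_chart M (U, \<phi>) \<and> x \<in> U \<and> subspace K \<and> dim K = k \<and>
        \<phi> ` (U \<inter> S) = \<phi> ` U \<inter> K)"

text \<open>
  The tangent space of \<open>M\<close> at \<open>x\<close> is the model space, identified through a fixed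
  preferred chart at \<open>x\<close>. Tangent vectors of a submanifold \<open>S\<close> are the velocities of the smooth
  curves in \<open>S\<close>. Curves only matter near time 0.
\<close>

definition chart_at :: "('a, 'e) atlas \<Rightarrow> 'a \<Rightarrow> ('a, 'e) chart" where
  "chart_at M x = (SOME c. c \<in> M \<and> x \<in> fst c)"

definition smooth_curve_in ::
    "('a, 'e::euclidean_space) atlas \<Rightarrow> 'a set \<Rightarrow> (real \<Rightarrow> 'a) \<Rightarrow> bool" where
  "smooth_curve_in M S c \<longleftrightarrow>
     (\<exists>e>0. c ` {-e<..<e} \<subseteq> S \<inter> fst (chart_at M (c 0)) \<and>
        smooth_on (snd (chart_at M (c 0)) \<circ> c) {-e<..<e})"

definition has_velocity ::
    "('a, 'e::euclidean_space) atlas \<Rightarrow> (real \<Rightarrow> 'a) \<Rightarrow> 'e \<Rightarrow> bool" where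
  "has_velocity M c v \<longleftrightarrow>
     (\<forall>\<^sub>F t in nhds 0. c t \<in> fst (chart_at M (c 0))) \<and>
     ((snd (chart_at M (c 0)) \<circ> c) has_vector_derivative v) (at 0)"

definition tangent_space ::
    "('a, 'e::euclidean_space) atlas \<Rightarrow> 'a set \<Rightarrow> 'a \<Rightarrow> 'e set" where
  "tangent_space M S x = {v. \<exists>c. smooth_curve_in M S c \<and> c 0 = x \<and> has_velocity M c v}"

text \<open>The velocity of \<open>f \<circ> c\<close>, for any curve \<open>c\<close> in the submanifold \<open>S\<close> with velocity \<open>v\<close> at \<open>x\<close>.\<close>

definition differential ::
    "('a, 'e::euclidean_space) atlas \<Rightarrow> 'a set \<Rightarrow> ('b, 'f::euclidean_space) atlas \<Rightarrow>
     ('a \<Rightarrow> 'b) \<Rightarrow> 'a \<Rightarrow> 'e \<Rightarrow> 'f" where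
  "differential M S N f x v =
     (THE w. \<forall>c. smooth_curve_in M S c \<and> c 0 = x \<and> has_velocity M c v \<longrightarrow>
        has_velocity N (f \<circ> c) w)"

definition transverse ::
    "('a, 'e::euclidean_space) atlas \<Rightarrow> 'a set \<Rightarrow> ('b, 'f::euclidean_space) atlas \<Rightarrow>
     ('a \<Rightarrow> 'b) \<Rightarrow> 'b set \<Rightarrow> bool" where
  "transverse M S N f Z \<longleftrightarrow>
     (\<forall>x\<in>S. f x \<in> Z \<longrightarrow>
        {a + b | a b. a \<in> differential M S N f x ` tangent_space M S x \<and>
                      b \<in> tangent_space N Z (f x)} = UNIV)"

text \<open>
  Two complementary frames \<open>f\<close>, \<open>g\<close> of a vector space of dimension \<open>CARD('k) + CARD('m)\<close>
  identify the matrices \<open>B\<close> with the \<open>CARD('k)\<close>-planes complementary to \<open>range g\<close>: the plane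
  of \<open>B\<close> is the graph of \<open>B\<close>, seen as a map from \<open>range f\<close> to \<open>range g\<close>. These are the standard
  charts of the Grassmannian; its points are all \<open>CARD('k)\<close>-dimensional subspaces.
\<close>

definition graph_plane ::
    "(real^'k \<Rightarrow> 'v::euclidean_space) \<Rightarrow> (real^'m \<Rightarrow> 'v) \<Rightarrow> real^'k^'m \<Rightarrow> 'v set" where
  "graph_plane f g B = range (\<lambda>x. f x + g (B *v x))"

definition grassmannian :: "('v::euclidean_space set, real^'k^'m) atlas" where
  "grassmannian =
     {(range (graph_plane f g), inv (graph_plane f g)) | f g.
        linear f \<and> linear g \<and> bij (\<lambda>(x, y). f x + g y)}"

definition planes_containing :: "('v::euclidean_space set, real^'k^'m) atlas \<Rightarrow> 'v set \<Rightarrow> 'v set set"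
  where "planes_containing G l = {E \<in> mcarrier G. l \<subseteq> E}"

text \<open>
  The canonical identification of the tangent space at \<open>E\<close> of the Grassmannian of \<open>V\<close> with
  \<open>Hom(E, V/E)\<close>: a tangent vector \<open>B\<close>, the velocity of a curve \<open>c\<close> of planes, sends \<open>v \<in> E\<close> to
  the class mod \<open>E\<close> of \<open>w'(0)\<close>, where \<open>w\<close> is any curve of vectors \<open>w t \<in> c t\<close> with \<open>w 0 = v\<close>.
  An element of \<open>V/E\<close> is a coset of \<open>E\<close>; the coset in question is just the set of all such
  derivatives \<open>w'(0)\<close>.
\<close>

definition grassmannian_hom ::
    "('v::euclidean_space set, real^'k^'m) atlas \<Rightarrow> 'v set \<Rightarrow> real^'k^'m \<Rightarrow> 'v \<Rightarrow> 'v set" where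
  "grassmannian_hom G E B v =
     {u. \<exists>c w. c 0 = E \<and> has_velocity G c B \<and>
           w 0 = v \<and> (\<forall>\<^sub>F t in nhds 0. w t \<in> c t) \<and> (w has_vector_derivative u) (at 0)}"

text \<open>
  The rank of a linear map \<open>A\<close> from \<open>E\<close> to \<open>V/E\<close> with coset values. The union of the cosets in
  the image of \<open>A\<close> is a subspace of \<open>V\<close> containing \<open>E\<close>, and the image is its quotient by \<open>E\<close>.
\<close>

definition coset_rank :: "'v::euclidean_space set \<Rightarrow> ('v \<Rightarrow> 'v set) \<Rightarrow> nat" where
  "coset_rank E A = dim (\<Union>v\<in>E. A v) - dim E"

definition join :: "'l set \<Rightarrow> ('p \<times> 'l) set \<Rightarrow> 'p \<Rightarrow> 'p \<Rightarrow> 'l" where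
  "join L F p q = (THE l. l \<in> L \<and> (p, l) \<in> F \<and> (q, l) \<in> F)"

definition meet :: "'p set \<Rightarrow> ('p \<times> 'l) set \<Rightarrow> 'l \<Rightarrow> 'l \<Rightarrow> 'p" where
  "meet P F l m = (THE p. p \<in> P \<and> (p, l) \<in> F \<and> (p, m) \<in> F)"

definition projective_plane :: "'p set \<Rightarrow> 'l set \<Rightarrow> ('p \<times> 'l) set \<Rightarrow> bool" where
  "projective_plane P L F \<longleftrightarrow>
     F \<subseteq> P \<times> L \<and>
     (\<forall>p\<in>P. \<forall>q\<in>P. p \<noteq> q \<longrightarrow> (\<exists>!l. l \<in> L \<and> (p, l) \<in> F \<and> (q, l) \<in> F)) \<and>
     (\<forall>l\<in>L. \<forall>m\<in>L. l \<noteq> m \<longrightarrow> (\<exists>!p. p \<in> P \<and> (p, l) \<in> F \<and> (p, m) \<in> F)) \<and>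
     (\<exists>Q\<subseteq>P. card Q = 4 \<and> (\<forall>l\<in>L. card {q \<in> Q. (q, l) \<in> F} \<le> 2))"

definition points_on :: "('p \<times> 'l) set \<Rightarrow> 'l \<Rightarrow> 'p set" where
  "points_on F l = {p. (p, l) \<in> F}"

definition lines_through :: "('p \<times> 'l) set \<Rightarrow> 'p \<Rightarrow> 'l set" where
  "lines_through F p = {l. (p, l) \<in> F}"

definition smooth_projective_plane ::
    "('p, 'e::euclidean_space) atlas \<Rightarrow> ('l, 'e) atlas \<Rightarrow> ('p \<times> 'l) set \<Rightarrow> bool" where
  "smooth_projective_plane P L F \<longleftrightarrow>
     projective_plane (mcarrier P) (mcarrier L) F \<and>
     smooth_manifold P \<and> compact_space (mtopology P) \<and>
     smooth_manifold L \<and> compact_space (mtopology L) \<and>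
     (\<exists>k. embedded_submanifold (prod_atlas P L) k F) \<and>
     smooth_map_on (prod_atlas P P) L {(p, q). p \<in> mcarrier P \<and> q \<in> mcarrier P \<and> p \<noteq> q}
       (\<lambda>(p, q). join (mcarrier L) F p q) \<and>
     smooth_map_on (prod_atlas L L) P {(l, m). l \<in> mcarrier L \<and> m \<in> mcarrier L \<and> l \<noteq> m}
       (\<lambda>(l, m). meet (mcarrier P) F l m)"

text \<open>
  For a regular plane the model space is \<open>(real^'n) \<times> (real^'n)\<close>, i.e. the dimension is \<open>2n\<close> with
  \<open>n = CARD('n)\<close>, and \<open>n\<close>-planes in a tangent space of \<open>P\<close> are points of a Grassmannian modelled
  on the \<open>n \<times> n\<close> matrices. The unoriented Grassmannian is used; the oriented one is a double
  cover of it, so transversality and tangent vectors are the same.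
\<close>

definition gauss :: "('p, 'e::euclidean_space) atlas \<Rightarrow> ('p \<times> 'l) set \<Rightarrow> 'p \<Rightarrow> 'l \<Rightarrow> 'e set" where
  "gauss P F p l = tangent_space P (points_on F l) p"

definition half_planes :: "(((real^'n) \<times> (real^'n)) set, real^'n^'n) atlas" where
  "half_planes = grassmannian"

definition regular_projective_plane ::
    "('p, (real^'n) \<times> (real^'n)) atlas \<Rightarrow> ('l, (real^'n) \<times> (real^'n)) atlas \<Rightarrow>
     ('p \<times> 'l) set \<Rightarrow> bool" where
  "regular_projective_plane P L F \<longleftrightarrow>
     smooth_projective_plane P L F \<and>
     (\<forall>p\<in>mcarrier P. \<forall>l. subspace l \<and> dim l = 1 \<longrightarrow>
        transverse L (lines_through F p) half_planes (gauss P F p)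
          (planes_containing half_planes l))"

text \<open>
  The tableau at \<open>(p, l) \<in> F\<close> of the first order system for plane curves, whose solutions are the
  immersions of \<open>n\<close>-manifolds tangent to some line at each point.
\<close>

definition plane_curve_tableau ::
    "('p, (real^'n) \<times> (real^'n)) atlas \<Rightarrow> ('l, (real^'n) \<times> (real^'n)) atlas \<Rightarrow>
     ('p \<times> 'l) set \<Rightarrow> 'p \<Rightarrow> 'l \<Rightarrow> ((real^'n) \<times> (real^'n) \<Rightarrow> ((real^'n) \<times> (real^'n)) set) set" where
  "plane_curve_tableau P L F p l =
     grassmannian_hom half_planes (gauss P F p l) `
       differential L (lines_through F p) half_planes (gauss P F p) l `
         tangent_space L (lines_through F p) l"

definition plane_curves_elliptic ::
    "('p, (real^'n) \<times> (real^'n)) atlas \<Rightarrow> ('l, (real^'n) \<times> (real^'n)) atlas \<Rightarrow>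
     ('p \<times> 'l) set \<Rightarrow> bool" where
  "plane_curves_elliptic P L F \<longleftrightarrow>
     (\<forall>(p, l)\<in>F. \<forall>A\<in>plane_curve_tableau P L F p l. coset_rank (gauss P F p l) A \<noteq> 1)"

end

(* Write T for the tangent space of the pencil of p at a line l, and E for the tangent space of l
   at p. Both have dimension n. The central projection from a point q off l is a smooth retraction
   onto l, so E is the range of its derivative; near p the plane is the product of any two lines
   through p, by projecting to each from a point of the other, so the tangent spaces of two lines
   through p have complementary dimensions, and since there are three lines, these are all n. For T
   argue dually. The projection depends smoothly on l, which makes the differential of the Gauss map
   a linear map on T. For nonzero v in E, transversality to the planes containing v says that
   evaluation at v maps the tableau onto the normal space of l at p, which has dimension n; as the
   tableau has dimension at most n, evaluation is injective on it. So its nonzero elements are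
   injective and have rank n > 1. *)

theory Submission
  imports Defs
begin

section \<open>Functions of class C^k\<close>

text \<open>In the chart of \<open>graph_plane f g\<close> a plane is the solution set of
  \<open>gcoord v = B *v fcoord v\<close>. Differentiating this equation along a curve of planes
  turns "contains w" into "the velocity kills \<open>fcoord w\<close>", and evaluation of a tangent
  vector at \<open>w\<close> into multiplication by \<open>fcoord w\<close>, so every rank in the
  argument is the rank of a matrix. The obstacle is that \<open>tangent_space\<close> and
  \<open>differential\<close> are defined through velocities of curves, so neither linearity nor
  dimension comes for free. For a tangent space they come from a retraction. For the Gauss map a
  formula is needed: for lines k near l through p, the derivative at p of the projection onto k from
  one fixed centre is a linear map whose range is the tangent space of k, and it depends
  differentiably on k because join and meet are smooth in both arguments together. The range of a
  moving linear map is then differentiated by a quotient rule for matrices. Linearity is what makes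
  the final count legitimate: a surjective linear map between spaces of equal dimension is
  injective.\<close>

lemma Ck_on_mono_set:
  assumes "Ck_on k f S" "T \<subseteq> S"
  shows "Ck_on k f T"
  using assms by (induction k arbitrary: f) (auto intro: continuous_on_subset)

lemma Ck_on_Suc_imp: "Ck_on (Suc k) f S \<Longrightarrow> Ck_on k f S"
proof (induction k arbitrary: f)
  case 0
  then show ?case
    by (auto intro!: continuous_at_imp_continuous_on differentiable_imp_continuous_within)
next
  case (Suc k)
  then show ?case by (subst Ck_on.simps) (subst (asm) (2) Ck_on.simps, blast)
qed

text \<open>Openness turns agreement on \<open>S\<close> into agreement near each of its points,
  which is what derivatives in full neighbourhoods depend on.\<close>

lemma Ck_on_cong:
  assumes "open S" "\<And>x. x \<in> S \<Longrightarrow> f x = g x" "Ck_on k f S"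
  shows "Ck_on k g S"
  using assms(2,3)
proof (induction k arbitrary: f g)
  case 0
  then show ?case by (simp cong: continuous_on_cong)
next
  case (Suc k)
  have d: "(g has_derivative frechet_derivative f (at x)) (at x)" if "x \<in> S" for x
  proof (rule has_derivative_transform_within_open[OF _ \<open>open S\<close> that])
    show "(f has_derivative frechet_derivative f (at x)) (at x)"
      using Suc.prems(2) that by (simp add: frechet_derivative_works)
  qed (use Suc.prems(1) in auto)
  have eq: "frechet_derivative f (at x) = frechet_derivative g (at x)" if "x \<in> S" for x
    using frechet_derivative_at[OF d[OF that]] .
  have "Ck_on k (\<lambda>x. frechet_derivative g (at x) v) S" for v
    by (rule Suc.IH[of "\<lambda>x. frechet_derivative f (at x) v"]) (use eq Suc.prems(2) in auto)
  then show ?case using d by (auto simp: differentiable_def)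
qed

text \<open>The definition speaks of \<open>frechet_derivative\<close>; here any formula
  \<open>f'\<close> for the derivative will do, so that the usual derivative rules apply in the
  inductions below.\<close>

lemma Ck_on_SucI:
  assumes "open S" "\<And>x. x \<in> S \<Longrightarrow> (f has_derivative f' x) (at x)"
    "\<And>v. Ck_on k (\<lambda>x. f' x v) S"
  shows "Ck_on (Suc k) f S"
proof -
  have "Ck_on k (\<lambda>x. frechet_derivative f (at x) v) S" for v
    by (rule Ck_on_cong[OF assms(1) _ assms(3)[of v]]) (use frechet_derivative_at[OF assms(2)] in auto)
  then show ?thesis using assms(2) by (auto simp: differentiable_def)
qed

lemma Ck_on_has_derivative:
  assumes "Ck_on (Suc k) f S" "x \<in> S"
  shows "(f has_derivative frechet_derivative f (at x)) (at x)"
  using assms by (simp add: frechet_derivative_works)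

lemma Ck_on_const: "open S \<Longrightarrow> Ck_on k (\<lambda>x. c) S"
  by (induction k arbitrary: c)
     (auto intro!: Ck_on_SucI[where f' = "\<lambda>x v. 0"] derivative_eq_intros simp del: Ck_on.simps(2))

lemma Ck_on_linear:
  assumes "open S" "bounded_linear f"
  shows "Ck_on k f S"
proof (cases k)
  case 0
  then show ?thesis using assms by (simp add: linear_continuous_on)
next
  case (Suc k')
  show ?thesis unfolding Suc
    by (rule Ck_on_SucI[where f' = "\<lambda>x. f"])
       (use assms in \<open>auto intro: bounded_linear_imp_has_derivative Ck_on_const\<close>)
qed

lemma Ck_on_add:
  assumes "open S" "Ck_on k f S" "Ck_on k g S"
  shows "Ck_on k (\<lambda>x. f x + g x) S"
  using assms(2,3)
proof (induction k arbitrary: f g)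
  case 0
  then show ?case by (auto intro: continuous_intros)
next
  case (Suc k)
  show ?case
    by (rule Ck_on_SucI[OF assms(1) has_derivative_add[OF Ck_on_has_derivative[OF Suc.prems(1)]
          Ck_on_has_derivative[OF Suc.prems(2)]]])
       (use Suc in auto)
qed

lemma Ck_on_Pair:
  assumes "open S" "Ck_on k f S" "Ck_on k g S"
  shows "Ck_on k (\<lambda>x. (f x, g x)) S"
  using assms(2,3)
proof (induction k arbitrary: f g)
  case 0
  then show ?case by (auto intro: continuous_intros)
next
  case (Suc k)
  show ?case
    by (rule Ck_on_SucI[OF assms(1) has_derivative_Pair[OF Ck_on_has_derivative[OF Suc.prems(1)]
          Ck_on_has_derivative[OF Suc.prems(2)]]])
       (use Suc in auto)
qed

lemma Ck_on_scaleR: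
  assumes "open S" "Ck_on k f S" "Ck_on k g S"
  shows "Ck_on k (\<lambda>x. f x *\<^sub>R g x) S"
  using assms(2,3)
proof (induction k arbitrary: f g)
  case 0
  then show ?case by (auto intro: continuous_intros)
next
  case (Suc k)
  show ?case
    by (rule Ck_on_SucI[OF assms(1) has_derivative_scaleR[OF Ck_on_has_derivative[OF Suc.prems(1)]
          Ck_on_has_derivative[OF Suc.prems(2)]]])
       (use Suc Ck_on_Suc_imp[OF Suc.prems(1)] Ck_on_Suc_imp[OF Suc.prems(2)] in
         \<open>auto intro!: Ck_on_add[OF assms(1)] Suc.IH\<close>)
qed

lemma Ck_on_sum:
  assumes "open S" "finite I" "\<And>i. i \<in> I \<Longrightarrow> Ck_on k (f i) S"
  shows "Ck_on k (\<lambda>x. \<Sum>i\<in>I. f i x) S"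
  using assms(2,3) by (induction I) (auto intro: Ck_on_const Ck_on_add assms(1))

lemma Ck_on_inner_const:
  assumes "open S" "Ck_on k f S"
  shows "Ck_on k (\<lambda>x. f x \<bullet> b) S"
  using assms(2)
proof (induction k arbitrary: f)
  case 0
  then show ?case by (auto intro: continuous_intros)
next
  case (Suc k)
  show ?case
    by (rule Ck_on_SucI[OF assms(1) has_derivative_inner_left[OF Ck_on_has_derivative[OF Suc.prems(1)]]])
       (use Suc in auto)
qed

text \<open>The chain rule differentiates \<open>g\<close> in the direction f'(x) v, which moves
  with x, while \<open>Ck_on\<close> controls derivatives in fixed directions only. Expanding this
  direction in the basis leaves a sum of products, and the induction hypothesis applies to the
  derivative of \<open>g\<close> in each basis direction.\<close>

lemma Ck_on_compose:
  assumes "open S" "open T" "f ` S \<subseteq> T" "Ck_on k f S" "Ck_on k g T"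
  shows "Ck_on k (\<lambda>x. g (f x)) S"
  using assms(4,5)
proof (induction k arbitrary: g)
  case 0
  then show ?case using continuous_on_compose2[OF _ _ assms(3)] by auto
next
  case (Suc k)
  let ?f' = "\<lambda>x. frechet_derivative f (at x)" and ?g' = "\<lambda>y. frechet_derivative g (at y)"
  let ?h' = "\<lambda>x v. \<Sum>b\<in>Basis. (?f' x v \<bullet> b) *\<^sub>R ?g' (f x) b"
  show ?case
  proof (rule Ck_on_SucI[OF assms(1), where f' = ?h'])
    fix x assume x: "x \<in> S"
    have g: "(g has_derivative ?g' (f x)) (at (f x))"
      using Ck_on_has_derivative[OF Suc.prems(2)] x assms(3) by auto
    have "?h' x = (\<lambda>v. ?g' (f x) (?f' x v))"
    proof
      fix v
      interpret linear "?g' (f x)" using g by (rule has_derivative_linear)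
      show "?h' x v = ?g' (f x) (?f' x v)"
        by (subst (4) euclidean_representation[symmetric]) (simp add: sum scaleR)
    qed
    then show "((\<lambda>x. g (f x)) has_derivative ?h' x) (at x)"
      using has_derivative_compose[OF Ck_on_has_derivative[OF Suc.prems(1) x] g] by simp
  next
    fix v
    show "Ck_on k (\<lambda>x. ?h' x v) S"
      using Suc.prems Ck_on_Suc_imp[OF Suc.prems(1)]
      by (intro Ck_on_sum Ck_on_scaleR Ck_on_inner_const assms(1) finite_Basis Suc.IH) auto
  qed
qed

lemma smooth_on_compose:
  assumes "open S" "open T" "f ` S \<subseteq> T" "smooth_on f S" "smooth_on g T"
  shows "smooth_on (\<lambda>x. g (f x)) S"
  using assms by (auto simp: smooth_on_def intro: Ck_on_compose)

lemma smooth_on_Pair: "open S \<Longrightarrow> smooth_on f S \<Longrightarrow> smooth_on g S \<Longrightarrow> smooth_on (\<lambda>x. (f x, g x)) S"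
  by (auto simp: smooth_on_def intro: Ck_on_Pair)

lemma smooth_on_const: "open S \<Longrightarrow> smooth_on (\<lambda>x. c) S"
  by (auto simp: smooth_on_def intro: Ck_on_const)

lemma smooth_on_linear: "open S \<Longrightarrow> bounded_linear f \<Longrightarrow> smooth_on f S"
  by (auto simp: smooth_on_def intro: Ck_on_linear)

lemma smooth_on_add: "open S \<Longrightarrow> smooth_on f S \<Longrightarrow> smooth_on g S \<Longrightarrow> smooth_on (\<lambda>x. f x + g x) S"
  by (auto simp: smooth_on_def intro: Ck_on_add)

lemma smooth_on_subset: "smooth_on f S \<Longrightarrow> T \<subseteq> S \<Longrightarrow> smooth_on f T"
  by (auto simp: smooth_on_def intro: Ck_on_mono_set)

lemma smooth_on_cong: "open S \<Longrightarrow> smooth_on f S \<Longrightarrow> (\<And>x. x \<in> S \<Longrightarrow> f x = g x) \<Longrightarrow> smooth_on g S"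
  by (auto simp: smooth_on_def intro: Ck_on_cong[of S f g])

lemma smooth_on_imp_continuous_on: "smooth_on f S \<Longrightarrow> continuous_on S f"
  by (metis Ck_on.simps(1) smooth_on_def)

lemma smooth_on_has_derivative:
  "smooth_on f S \<Longrightarrow> x \<in> S \<Longrightarrow> (f has_derivative frechet_derivative f (at x)) (at x)"
  using Ck_on_has_derivative smooth_on_def by blast

text \<open>Needed for a mixed second derivative: how the derivative of a projection at a point
  varies with the line.\<close>

lemma smooth_on_frechet_derivative_differentiable:
  assumes "smooth_on f S" "x \<in> S"
  shows "(\<lambda>y. frechet_derivative f (at y) v) differentiable (at x)"
proof -
  have "Ck_on 2 f S" using assms by (simp add: smooth_on_def)
  then show ?thesis using assms(2) by (simp add: numeral_2_eq_2)
qed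

section \<open>Calculus in charts\<close>

text \<open>A chart on its own, without its atlas: derivatives below are taken in given charts of
  source and target, and products of charts require no product manifold.\<close>

definition is_chart :: "('a, 'e::euclidean_space) chart \<Rightarrow> bool" where
  "is_chart c \<longleftrightarrow> inj_on (snd c) (fst c) \<and> open (snd c ` fst c)"

definition prod_chart :: "('a, 'e) chart \<Rightarrow> ('b, 'f) chart \<Rightarrow> ('a \<times> 'b, 'e \<times> 'f) chart" where
  "prod_chart c d = (fst c \<times> fst d, map_prod (snd c) (snd d))"

text \<open>The neighbourhood filter of \<open>x\<close> read off from one chart, where a part of
  the domain counts as open if its coordinate image is.\<close>

definition near :: "('a, 'e::euclidean_space) chart \<Rightarrow> 'a \<Rightarrow> ('a \<Rightarrow> bool) \<Rightarrow> bool" where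
  "near c x Q \<longleftrightarrow> (\<exists>W\<subseteq>fst c. x \<in> W \<and> open (snd c ` W) \<and> (\<forall>y\<in>W. Q y))"

definition coord_rep ::
    "('a, 'e) chart \<Rightarrow> ('b, 'f) chart \<Rightarrow> ('a \<Rightarrow> 'b) \<Rightarrow> 'e \<Rightarrow> 'f" where
  "coord_rep c d f = snd d \<circ> f \<circ> inv_into (fst c) (snd c)"

definition smooth_at ::
    "('a, 'e::euclidean_space) chart \<Rightarrow> ('b, 'f::euclidean_space) chart \<Rightarrow> ('a \<Rightarrow> 'b) \<Rightarrow> 'a \<Rightarrow> bool" where
  "smooth_at c d f x \<longleftrightarrow>
     (\<exists>W\<subseteq>fst c. x \<in> W \<and> open (snd c ` W) \<and> f ` W \<subseteq> fst d \<and> smooth_on (coord_rep c d f) (snd c ` W))"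

definition coord_deriv ::
    "('a, 'e::euclidean_space) chart \<Rightarrow> ('b, 'f::euclidean_space) chart \<Rightarrow> ('a \<Rightarrow> 'b) \<Rightarrow> 'a \<Rightarrow> 'e \<Rightarrow> 'f"
  where "coord_deriv c d f x = frechet_derivative (coord_rep c d f) (at (snd c x))"

lemma is_chart_inv [simp]: "is_chart c \<Longrightarrow> x \<in> fst c \<Longrightarrow> inv_into (fst c) (snd c) (snd c x) = x"
  by (simp add: is_chart_def)

lemma coord_rep_chart [simp]: "is_chart c \<Longrightarrow> x \<in> fst c \<Longrightarrow> coord_rep c d f (snd c x) = snd d (f x)"
  by (simp add: coord_rep_def)

lemma is_chart_image_Int:
  "is_chart c \<Longrightarrow> V \<subseteq> fst c \<Longrightarrow> W \<subseteq> fst c \<Longrightarrow> snd c ` (V \<inter> W) = snd c ` V \<inter> snd c ` W"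
  unfolding is_chart_def by (elim conjE) (rule inj_on_image_Int)

lemma fst_prod_chart [simp]: "fst (prod_chart c d) = fst c \<times> fst d"
  by (simp add: prod_chart_def)

lemma snd_prod_chart [simp]: "snd (prod_chart c d) (x, y) = (snd c x, snd d y)"
  by (simp add: prod_chart_def)

lemma snd_prod_chart_image: "snd (prod_chart c d) ` (V \<times> W) = snd c ` V \<times> snd d ` W"
  by (simp add: prod_chart_def map_prod_surj_on[OF refl refl])

lemma is_chart_prod: "is_chart c \<Longrightarrow> is_chart d \<Longrightarrow> is_chart (prod_chart c d)"
  unfolding is_chart_def fst_prod_chart snd_prod_chart_image
  by (auto intro: open_Times) (auto simp: prod_chart_def intro: map_prod_inj_on)

lemma coord_rep_prod_chart [simp]:
  assumes "is_chart c" "is_chart d" "x \<in> fst c" "y \<in> fst d"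
  shows "coord_rep (prod_chart c d) e f (snd c x, snd d y) = snd e (f (x, y))"
  using coord_rep_chart[OF is_chart_prod[OF assms(1,2)], of "(x, y)" e f] assms(3,4) by simp

lemma near_mem: "near c x Q \<Longrightarrow> Q x"
  by (auto simp: near_def)

lemma near_mono: "near c x Q \<Longrightarrow> (\<And>y. y \<in> fst c \<Longrightarrow> Q y \<Longrightarrow> R y) \<Longrightarrow> near c x R"
  unfolding near_def by blast

lemma near_self: "is_chart c \<Longrightarrow> x \<in> fst c \<Longrightarrow> near c x (\<lambda>y. y \<in> fst c)"
  unfolding near_def is_chart_def by blast

lemma near_conj:
  assumes "is_chart c" "near c x Q" "near c x R"
  shows "near c x (\<lambda>y. Q y \<and> R y)"
proof -
  obtain V where V: "V \<subseteq> fst c" "x \<in> V" "open (snd c ` V)" "\<forall>y\<in>V. Q y"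
    using assms(2) unfolding near_def by blast
  obtain W where W: "W \<subseteq> fst c" "x \<in> W" "open (snd c ` W)" "\<forall>y\<in>W. R y"
    using assms(3) unfolding near_def by blast
  have "open (snd c ` (V \<inter> W))"
    using V W by (simp add: is_chart_image_Int[OF assms(1)] open_Int)
  then show ?thesis
    unfolding near_def using V W by (intro exI[of _ "V \<inter> W"]) auto
qed

lemma near_conj_iff: "is_chart c \<Longrightarrow> near c x (\<lambda>y. Q y \<and> R y) \<longleftrightarrow> near c x Q \<and> near c x R"
  using near_conj[of c x Q R] near_mono[of c x "\<lambda>y. Q y \<and> R y"] by blast

lemma near_prod:
  assumes "near c x Q" "near d y R"
  shows "near (prod_chart c d) (x, y) (\<lambda>z. Q (fst z) \<and> R (snd z))"
proof -
  obtain V where V: "V \<subseteq> fst c" "x \<in> V" "open (snd c ` V)" "\<forall>y\<in>V. Q y"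
    using assms(1) unfolding near_def by blast
  obtain W where W: "W \<subseteq> fst d" "y \<in> W" "open (snd d ` W)" "\<forall>y\<in>W. R y"
    using assms(2) unfolding near_def by blast
  have "open (snd (prod_chart c d) ` (V \<times> W))"
    using V W by (simp add: snd_prod_chart_image open_Times)
  then show ?thesis
    unfolding near_def using V W by (intro exI[of _ "V \<times> W"]) auto
qed

lemma near_eventually:
  assumes "is_chart c" "near c x Q"
  shows "\<forall>\<^sub>F a in nhds (snd c x). \<exists>y\<in>fst c. a = snd c y \<and> Q y"
proof -
  obtain W where W: "W \<subseteq> fst c" "x \<in> W" "open (snd c ` W)" "\<forall>y\<in>W. Q y"
    using assms(2) unfolding near_def by blast
  have "\<forall>\<^sub>F a in nhds (snd c x). a \<in> snd c ` W"
    using W(2,3) by (intro eventually_nhds_in_open) auto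
  then show ?thesis by eventually_elim (use W in blast)
qed

lemma has_derivative_cong_nhds:
  assumes "(f has_derivative f') (at x)" "\<forall>\<^sub>F y in nhds x. f y = g y"
  shows "(g has_derivative f') (at x)"
proof -
  obtain S where "open S" "x \<in> S" "\<forall>y\<in>S. f y = g y"
    using assms(2) unfolding eventually_nhds by blast
  then show ?thesis using has_derivative_transform_within_open[OF assms(1)] by blast
qed

lemma smooth_atE:
  assumes "smooth_at c d f x"
  obtains W where "W \<subseteq> fst c" "x \<in> W" "open (snd c ` W)" "f ` W \<subseteq> fst d"
    "smooth_on (coord_rep c d f) (snd c ` W)"
  using assms unfolding smooth_at_def by blast

lemma smooth_at_in_chart: "smooth_at c d f x \<Longrightarrow> x \<in> fst c" "smooth_at c d f x \<Longrightarrow> f x \<in> fst d"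
  by (auto simp: smooth_at_def)

lemma near_smooth_at:
  assumes "smooth_at c d f x"
  shows "near c x (smooth_at c d f)"
  using assms unfolding smooth_at_def near_def by blast

lemma smooth_at_preimage:
  assumes c: "is_chart c" and W: "W \<subseteq> fst c" "open (snd c ` W)" "f ` W \<subseteq> fst d"
    "smooth_on (coord_rep c d f) (snd c ` W)"
    and V: "V \<subseteq> fst d" "open (snd d ` V)" and d: "is_chart d"
  shows "open (snd c ` {y \<in> W. f y \<in> V})"
proof -
  have "f y \<in> V \<longleftrightarrow> snd d (f y) \<in> snd d ` V" if "y \<in> W" for y
    using that W(3) V(1) d by (metis imageI image_subset_iff inj_on_image_mem_iff is_chart_def)
  then have "snd c ` {y \<in> W. f y \<in> V} = snd c ` W \<inter> coord_rep c d f -` (snd d ` V)"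
    using c W(1) by (auto simp: subset_iff)
  also have "open \<dots>"
    using W(2) V(2) smooth_on_imp_continuous_on[OF W(4)] by (simp add: continuous_open_preimage)
  finally show ?thesis .
qed

lemma near_compose:
  assumes "is_chart c" "is_chart d" "smooth_at c d f x" "near d (f x) Q"
  shows "near c x (\<lambda>y. Q (f y))"
proof -
  obtain W where W: "W \<subseteq> fst c" "x \<in> W" "open (snd c ` W)" "f ` W \<subseteq> fst d"
    "smooth_on (coord_rep c d f) (snd c ` W)" using assms(3) by (rule smooth_atE)
  obtain V where V: "V \<subseteq> fst d" "f x \<in> V" "open (snd d ` V)" "\<forall>y\<in>V. Q y"
    using assms(4) unfolding near_def by blast
  have "open (snd c ` {y \<in> W. f y \<in> V})"
    using smooth_at_preimage[OF assms(1) W(1,3,4,5) V(1,3) assms(2)] .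
  then show ?thesis
    unfolding near_def using W V by (intro exI[of _ "{y \<in> W. f y \<in> V}"]) auto
qed

lemma smooth_at_compose:
  assumes "is_chart c" "is_chart d" "smooth_at c d f x" "smooth_at d e g (f x)"
  shows "smooth_at c e (\<lambda>y. g (f y)) x"
proof -
  obtain W where W: "W \<subseteq> fst c" "x \<in> W" "open (snd c ` W)" "f ` W \<subseteq> fst d"
    "smooth_on (coord_rep c d f) (snd c ` W)" using assms(3) by (rule smooth_atE)
  obtain V where V: "V \<subseteq> fst d" "f x \<in> V" "open (snd d ` V)" "g ` V \<subseteq> fst e"
    "smooth_on (coord_rep d e g) (snd d ` V)" using assms(4) by (rule smooth_atE)
  let ?W = "{y \<in> W. f y \<in> V}"
  have o: "open (snd c ` ?W)"
    using smooth_at_preimage[OF assms(1) W(1,3,4,5) V(1,3) assms(2)] .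
  have "smooth_on (\<lambda>a. coord_rep d e g (coord_rep c d f a)) (snd c ` ?W)"
    by (rule smooth_on_compose[OF o V(3) _ smooth_on_subset[OF W(5)] V(5)])
       (use W assms(1) in auto)
  then have "smooth_on (coord_rep c e (\<lambda>y. g (f y))) (snd c ` ?W)"
    by (rule smooth_on_cong[OF o]) (use W V assms(1,2) in \<open>auto simp: subset_iff\<close>)
  then show ?thesis
    unfolding smooth_at_def using o W V by (intro exI[of _ ?W]) auto
qed

lemma smooth_at_const: "is_chart c \<Longrightarrow> x \<in> fst c \<Longrightarrow> k \<in> fst d \<Longrightarrow> smooth_at c d (\<lambda>_. k) x"
  unfolding smooth_at_def is_chart_def
  by (intro exI[of _ "fst c"]) (auto simp: coord_rep_def comp_def smooth_on_const)

lemma smooth_at_id: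
  assumes "is_chart c" "x \<in> fst c"
  shows "smooth_at c c (\<lambda>x. x) x"
proof -
  have o: "open (snd c ` fst c)" using assms by (simp add: is_chart_def)
  have "smooth_on (coord_rep c c (\<lambda>x. x)) (snd c ` fst c)"
    by (rule smooth_on_cong[OF o smooth_on_linear[OF o bounded_linear_ident]]) (use assms in auto)
  then show ?thesis
    unfolding smooth_at_def using o assms by (intro exI[of _ "fst c"]) auto
qed

lemma smooth_at_fst:
  assumes "is_chart c" "is_chart d" "z \<in> fst c \<times> fst d"
  shows "smooth_at (prod_chart c d) c fst z"
proof -
  note p = is_chart_prod[OF assms(1,2)]
  have o: "open (snd (prod_chart c d) ` (fst c \<times> fst d))" using p by (simp add: is_chart_def)
  have "smooth_on (coord_rep (prod_chart c d) c fst) (snd (prod_chart c d) ` (fst c \<times> fst d))"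
    by (rule smooth_on_cong[OF o smooth_on_linear[OF o bounded_linear_fst]]) (use assms p in auto)
  then show ?thesis
    unfolding smooth_at_def using o assms by (intro exI[of _ "fst c \<times> fst d"]) auto
qed

lemma smooth_at_snd:
  assumes "is_chart c" "is_chart d" "z \<in> fst c \<times> fst d"
  shows "smooth_at (prod_chart c d) d snd z"
proof -
  note p = is_chart_prod[OF assms(1,2)]
  have o: "open (snd (prod_chart c d) ` (fst c \<times> fst d))" using p by (simp add: is_chart_def)
  have "smooth_on (coord_rep (prod_chart c d) d snd) (snd (prod_chart c d) ` (fst c \<times> fst d))"
    by (rule smooth_on_cong[OF o smooth_on_linear[OF o bounded_linear_snd]]) (use assms p in auto)
  then show ?thesis
    unfolding smooth_at_def using o assms by (intro exI[of _ "fst c \<times> fst d"]) auto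
qed

lemma smooth_at_Pair:
  assumes "is_chart c" "smooth_at c d f x" "smooth_at c e g x"
  shows "smooth_at c (prod_chart d e) (\<lambda>y. (f y, g y)) x"
proof -
  obtain W where W: "W \<subseteq> fst c" "x \<in> W" "open (snd c ` W)" "f ` W \<subseteq> fst d"
    "smooth_on (coord_rep c d f) (snd c ` W)" using assms(2) by (rule smooth_atE)
  obtain V where V: "V \<subseteq> fst c" "x \<in> V" "open (snd c ` V)" "g ` V \<subseteq> fst e"
    "smooth_on (coord_rep c e g) (snd c ` V)" using assms(3) by (rule smooth_atE)
  have o: "open (snd c ` (W \<inter> V))"
    using W V by (simp add: is_chart_image_Int[OF assms(1)] open_Int)
  have "smooth_on (\<lambda>a. (coord_rep c d f a, coord_rep c e g a)) (snd c ` (W \<inter> V))"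
    by (intro smooth_on_Pair o smooth_on_subset[OF W(5)] smooth_on_subset[OF V(5)]) auto
  moreover have "(\<lambda>a. (coord_rep c d f a, coord_rep c e g a)) =
      coord_rep c (prod_chart d e) (\<lambda>y. (f y, g y))"
    by (simp add: coord_rep_def fun_eq_iff)
  ultimately show ?thesis
    unfolding smooth_at_def using o W V by (intro exI[of _ "W \<inter> V"]) auto
qed

lemma coord_deriv_works:
  assumes "smooth_at c d f x"
  shows "(coord_rep c d f has_derivative coord_deriv c d f x) (at (snd c x))"
  using assms unfolding coord_deriv_def
  by (elim smooth_atE) (rule smooth_on_has_derivative, assumption, rule imageI)

lemma linear_coord_deriv: "smooth_at c d f x \<Longrightarrow> linear (coord_deriv c d f x)"
  by (rule has_derivative_linear[OF coord_deriv_works])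

lemma coord_deriv_unique:
  assumes "(coord_rep c d f has_derivative f') (at (snd c x))"
  shows "coord_deriv c d f x = f'"
  unfolding coord_deriv_def by (rule frechet_derivative_at[OF assms, symmetric])

lemma coord_rep_cong:
  assumes "is_chart c" "near c x (\<lambda>y. f y = g y)"
  shows "\<forall>\<^sub>F a in nhds (snd c x). coord_rep c d f a = coord_rep c d g a"
  using near_eventually[OF assms] by eventually_elim (use assms(1) in auto)

lemma coord_deriv_cong:
  assumes "is_chart c" "smooth_at c d f x" "near c x (\<lambda>y. f y = g y)"
  shows "coord_deriv c d g x = coord_deriv c d f x"
proof (rule coord_deriv_unique)
  show "(coord_rep c d g has_derivative coord_deriv c d f x) (at (snd c x))"
    using has_derivative_cong_nhds[OF coord_deriv_works[OF assms(2)] coord_rep_cong[OF assms(1,3)]] .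
qed

lemma coord_deriv_compose:
  assumes "is_chart c" "is_chart d" "smooth_at c d f x" "smooth_at d e g (f x)"
  shows "coord_deriv c e (\<lambda>y. g (f y)) x v = coord_deriv d e g (f x) (coord_deriv c d f x v)"
proof -
  have x: "x \<in> fst c" using assms(3) by (rule smooth_at_in_chart)
  have fx: "f x \<in> fst d" using assms(3) by (rule smooth_at_in_chart)
  have "near c x (\<lambda>y. f y \<in> fst d)"
    by (rule near_mono[OF near_smooth_at[OF assms(3)] smooth_at_in_chart(2)])
  then have ev: "\<forall>\<^sub>F a in nhds (snd c x). coord_rep d e g (coord_rep c d f a) = coord_rep c e (\<lambda>y. g (f y)) a"
    by (rule eventually_mono[OF near_eventually[OF assms(1)]]) (auto simp: assms(1,2))
  have "((\<lambda>a. coord_rep d e g (coord_rep c d f a)) has_derivative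
      (\<lambda>v. coord_deriv d e g (f x) (coord_deriv c d f x v))) (at (snd c x))"
    using has_derivative_compose[OF coord_deriv_works[OF assms(3)]] coord_deriv_works[OF assms(4)]
    by (simp add: x assms(1))
  then have "(coord_rep c e (\<lambda>y. g (f y)) has_derivative
      (\<lambda>v. coord_deriv d e g (f x) (coord_deriv c d f x v))) (at (snd c x))"
    using ev by (rule has_derivative_cong_nhds)
  then show ?thesis by (simp add: coord_deriv_unique)
qed

lemma coord_deriv_id:
  assumes "is_chart c" "x \<in> fst c"
  shows "coord_deriv c c (\<lambda>x. x) x v = v"
proof -
  have "\<forall>\<^sub>F a in nhds (snd c x). a = coord_rep c c (\<lambda>x. x) a"
    using near_eventually[OF assms(1) near_self[OF assms]] by eventually_elim (use assms(1) in auto)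
  then have "(coord_rep c c (\<lambda>x. x) has_derivative (\<lambda>v. v)) (at (snd c x))"
    by (rule has_derivative_cong_nhds[OF has_derivative_ident])
  then show ?thesis by (simp add: coord_deriv_unique)
qed

lemma coord_deriv_const: "coord_deriv c d (\<lambda>_. k) x v = 0"
proof -
  have "(coord_rep c d (\<lambda>_. k) has_derivative (\<lambda>_. 0)) (at (snd c x))"
    by (simp add: coord_rep_def comp_def)
  then show ?thesis by (simp add: coord_deriv_unique)
qed

lemma coord_deriv_Pair:
  assumes "smooth_at c d f x" "smooth_at c e g x"
  shows "coord_deriv c (prod_chart d e) (\<lambda>y. (f y, g y)) x v = (coord_deriv c d f x v, coord_deriv c e g x v)"
proof -
  have "coord_rep c (prod_chart d e) (\<lambda>y. (f y, g y)) = (\<lambda>a. (coord_rep c d f a, coord_rep c e g a))"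
    by (simp add: coord_rep_def fun_eq_iff)
  then have "(coord_rep c (prod_chart d e) (\<lambda>y. (f y, g y)) has_derivative
      (\<lambda>v. (coord_deriv c d f x v, coord_deriv c e g x v))) (at (snd c x))"
    using has_derivative_Pair[OF coord_deriv_works[OF assms(1)] coord_deriv_works[OF assms(2)]] by simp
  then show ?thesis by (simp add: coord_deriv_unique)
qed

text \<open>The chain rule along x \<mapsto> (y, x), whose derivative is v \<mapsto> (0, v). It
  turns smoothness of a family, jointly in parameter and point, into derivatives of its
  members.\<close>

lemma coord_deriv_slice:
  assumes "is_chart c" "is_chart d" "smooth_at (prod_chart c d) e (\<lambda>(y, x). f y x) (y, x)"
  shows "smooth_at d e (f y) x"
    and "coord_deriv d e (f y) x v = coord_deriv (prod_chart c d) e (\<lambda>(y, x). f y x) (y, x) (0, v)"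
proof -
  have y: "y \<in> fst c" "x \<in> fst d" using smooth_at_in_chart(1)[OF assms(3)] by auto
  have s: "smooth_at d (prod_chart c d) (\<lambda>x. (y, x)) x"
    by (intro smooth_at_Pair smooth_at_const smooth_at_id assms y)
  show "smooth_at d e (f y) x"
    using smooth_at_compose[OF assms(2) is_chart_prod[OF assms(1,2)] s assms(3)] by simp
  show "coord_deriv d e (f y) x v = coord_deriv (prod_chart c d) e (\<lambda>(y, x). f y x) (y, x) (0, v)"
    using coord_deriv_compose[OF assms(2) is_chart_prod[OF assms(1,2)] s assms(3)]
    by (simp add: coord_deriv_Pair smooth_at_const smooth_at_id assms y coord_deriv_const coord_deriv_id)
qed

section \<open>Manifolds and tangent spaces\<close>

text \<open>Continuity of the transitions already relates the topology to each chart, and it passes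
  to products with little work.\<close>

definition continuous_atlas :: "('a, 'e::euclidean_space) atlas \<Rightarrow> bool" where
  "continuous_atlas M \<longleftrightarrow> (\<forall>c\<in>M. is_chart c \<and> (\<forall>d\<in>M. open (snd c ` (fst c \<inter> fst d)) \<and>
     continuous_on (snd c ` (fst c \<inter> fst d)) (snd d \<circ> inv_into (fst c) (snd c))))"

lemma smooth_manifold_is_chart: "smooth_manifold M \<Longrightarrow> c \<in> M \<Longrightarrow> is_chart c"
  by (simp add: smooth_manifold_def smooth_chart_def is_chart_def)

lemma smooth_manifold_continuous_atlas: "smooth_manifold M \<Longrightarrow> continuous_atlas M"
  unfolding continuous_atlas_def smooth_manifold_def smooth_chart_def smooth_transition_def is_chart_def
  by (metis smooth_on_imp_continuous_on)

lemma prod_atlas_eq: "prod_atlas M N = {prod_chart c d | c d. c \<in> M \<and> d \<in> N}"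
  unfolding prod_atlas_def prod_chart_def by force

lemma continuous_atlas_prod:
  assumes "continuous_atlas M" "continuous_atlas N"
  shows "continuous_atlas (prod_atlas M N)"
proof -
  have "open (snd (prod_chart c c') ` (fst (prod_chart c c') \<inter> fst (prod_chart d d'))) \<and>
     continuous_on (snd (prod_chart c c') ` (fst (prod_chart c c') \<inter> fst (prod_chart d d')))
       (snd (prod_chart d d') \<circ> inv_into (fst (prod_chart c c')) (snd (prod_chart c c')))"
    if cd: "c \<in> M" "d \<in> M" "c' \<in> N" "d' \<in> N" for c d c' d'
  proof -
    let ?D = "snd c ` (fst c \<inter> fst d)" and ?D' = "snd c' ` (fst c' \<inter> fst d')"
    have eq: "snd (prod_chart c c') ` (fst (prod_chart c c') \<inter> fst (prod_chart d d')) = ?D \<times> ?D'"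
      by (simp add: Times_Int_Times snd_prod_chart_image)
    have c: "is_chart c" "is_chart c'" "open ?D" "open ?D'"
      "continuous_on ?D (snd d \<circ> inv_into (fst c) (snd c))"
      "continuous_on ?D' (snd d' \<circ> inv_into (fst c') (snd c'))"
      using assms cd by (auto simp: continuous_atlas_def)
    have "continuous_on (?D \<times> ?D') (\<lambda>z. ((snd d \<circ> inv_into (fst c) (snd c)) (fst z),
        (snd d' \<circ> inv_into (fst c') (snd c')) (snd z)))"
      by (intro continuous_on_Pair continuous_on_compose2[OF c(5)] continuous_on_compose2[OF c(6)]
          continuous_on_fst continuous_on_snd continuous_on_id) auto
    moreover have "(snd (prod_chart d d') \<circ> inv_into (fst (prod_chart c c')) (snd (prod_chart c c'))) z =
        ((snd d \<circ> inv_into (fst c) (snd c)) (fst z), (snd d' \<circ> inv_into (fst c') (snd c')) (snd z))"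
      if z: "z \<in> ?D \<times> ?D'" for z
    proof -
      obtain x y where xy: "x \<in> fst c" "y \<in> fst c'" "z = snd (prod_chart c c') (x, y)"
        using z by auto
      then have "inv_into (fst (prod_chart c c')) (snd (prod_chart c c')) z = (x, y)"
        using is_chart_inv[OF is_chart_prod[OF c(1,2)], of "(x, y)"] by simp
      then show ?thesis using xy c(1,2) by simp
    qed
    ultimately show ?thesis
      unfolding eq using c(3,4) by (auto intro: open_Times cong: continuous_on_cong)
  qed
  moreover have "is_chart (prod_chart c d)" if "c \<in> M" "d \<in> N" for c d
    using assms that by (auto simp: continuous_atlas_def intro: is_chart_prod)
  ultimately show ?thesis
    unfolding continuous_atlas_def prod_atlas_eq by blast
qed

text \<open>The topology is generated by sets taken from all charts. Seen in another chart such a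
  set is the preimage of an open set under a transition map; the induction follows the generation of
  the topology.\<close>

lemma openin_mtopology_chart_image:
  assumes M: "continuous_atlas M" "c \<in> M" and T: "openin (mtopology M) T"
  shows "open (snd c ` (fst c \<inter> T))"
proof -
  have c: "is_chart c" using M by (simp add: continuous_atlas_def)
  have "generate_topology_on {{x \<in> U. \<phi> x \<in> V} | U \<phi> V. (U, \<phi>) \<in> M \<and> open V} T"
    using T by (simp add: mtopology_def openin_topology_generated_by_iff)
  then show ?thesis
  proof induction
    case Empty
    then show ?case by simp
  next
    case (Int a b)
    have "fst c \<inter> (a \<inter> b) = (fst c \<inter> a) \<inter> (fst c \<inter> b)" by blast
    then have "snd c ` (fst c \<inter> (a \<inter> b)) = snd c ` (fst c \<inter> a) \<inter> snd c ` (fst c \<inter> b)"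
      by (simp add: is_chart_image_Int[OF c])
    then show ?case using Int by (simp add: open_Int)
  next
    case (UN K)
    have "snd c ` (fst c \<inter> \<Union>K) = (\<Union>k\<in>K. snd c ` (fst c \<inter> k))" by blast
    then show ?case using UN by (simp add: open_UN)
  next
    case (Basis s)
    then obtain d V where d: "d \<in> M" "open V" "s = {x \<in> fst d. snd d x \<in> V}" by force
    let ?D = "snd c ` (fst c \<inter> fst d)"
    have "snd c ` (fst c \<inter> s) = ?D \<inter> (snd d \<circ> inv_into (fst c) (snd c)) -` V"
      using c d(3) by auto
    also have "open \<dots>"
      using M d(1,2) by (intro continuous_open_preimage) (auto simp: continuous_atlas_def)
    finally show ?case .
  qed
qed

lemma topspace_mtopology: "topspace (mtopology M) = mcarrier M"
proof
  show "topspace (mtopology M) \<subseteq> mcarrier M"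
    by (force simp: mtopology_def topology_generated_by_topspace mcarrier_def)
  show "mcarrier M \<subseteq> topspace (mtopology M)"
    unfolding mtopology_def topology_generated_by_topspace mcarrier_def
  proof
    fix x assume "x \<in> (\<Union>c\<in>M. fst c)"
    then obtain U \<phi> where "(U, \<phi>) \<in> M" "x \<in> {x \<in> U. \<phi> x \<in> UNIV}" by force
    then show "x \<in> \<Union>{{x \<in> U. \<phi> x \<in> V} | U \<phi> V. (U, \<phi>) \<in> M \<and> open V}" by blast
  qed
qed

lemma openin_mtopology_chart: "c \<in> M \<Longrightarrow> openin (mtopology M) (fst c)"
  unfolding mtopology_def
  by (rule topology_generated_by_Basis, rule CollectI)
     (rule exI[of _ "fst c"], rule exI[of _ "snd c"], rule exI[of _ UNIV], auto)

lemma near_openin: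
  assumes "continuous_atlas M" "c \<in> M" "x \<in> fst c" "x \<in> T" "openin (mtopology M) T"
  shows "near c x (\<lambda>y. y \<in> T)"
  unfolding near_def using assms openin_mtopology_chart_image[OF assms(1,2,5)]
  by (intro exI[of _ "fst c \<inter> T"]) auto

text \<open>\<open>smooth_map_on\<close> gives smoothness of the coordinate expression on the set
  sent into the domain of \<open>d\<close>; continuity of \<open>f\<close> supplies a neighbourhood
  of \<open>x\<close> inside that set.\<close>

lemma smooth_map_on_smooth_at:
  assumes M: "continuous_atlas M" and f: "smooth_map_on M N W f" and cd: "c \<in> M" "d \<in> N"
    and near: "near c x (\<lambda>y. y \<in> W)" and fx: "f x \<in> fst d"
  shows "smooth_at c d f x"
proof -
  have c: "is_chart c" using M cd by (simp add: continuous_atlas_def)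
  obtain V where V: "V \<subseteq> fst c" "x \<in> V" "open (snd c ` V)" "\<forall>y\<in>V. y \<in> W"
    using near unfolding near_def by blast
  have "openin (subtopology (mtopology M) W) {y \<in> topspace (subtopology (mtopology M) W). f y \<in> fst d}"
    by (rule openin_continuous_map_preimage[OF _ openin_mtopology_chart[OF cd(2)]])
       (use f in \<open>simp add: smooth_map_on_def\<close>)
  then obtain T where T: "openin (mtopology M) T"
    "{y \<in> topspace (subtopology (mtopology M) W). f y \<in> fst d} = T \<inter> W"
    unfolding openin_subtopology by blast
  have U: "fst c \<subseteq> mcarrier M" using cd by (auto simp: mcarrier_def)
  let ?W = "V \<inter> (fst c \<inter> T)"
  have o: "open (snd c ` ?W)"
    using V openin_mtopology_chart_image[OF M cd(1) T(1)]
    by (simp add: is_chart_image_Int[OF c] open_Int)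
  have T2: "y \<in> T \<longleftrightarrow> f y \<in> fst d" if "y \<in> fst c" "y \<in> W" for y
    using that T(2) U by (auto simp: topspace_mtopology)
  have "smooth_on (coord_rep c d f) (snd c ` {x \<in> fst c \<inter> W. f x \<in> fst d})"
    using f cd unfolding smooth_map_on_def coord_rep_def by (auto split: prod.splits)
  then have "smooth_on (coord_rep c d f) (snd c ` ?W)"
    by (rule smooth_on_subset) (use T2 V in auto)
  moreover have "x \<in> ?W" "f ` ?W \<subseteq> fst d" using T2 V fx by auto
  ultimately show ?thesis
    unfolding smooth_at_def using o by (intro exI[of _ ?W]) auto
qed

lemma near_neq:
  assumes M: "smooth_manifold M" and cd: "c \<in> M" "d \<in> M" "x \<in> fst c" "y \<in> fst d" and "x \<noteq> y"
  shows "near (prod_chart c d) (x, y) (\<lambda>z. fst z \<noteq> snd z)"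
proof -
  have "x \<in> topspace (mtopology M)" "y \<in> topspace (mtopology M)"
    using cd by (auto simp: topspace_mtopology mcarrier_def)
  then obtain A B where AB: "openin (mtopology M) A" "openin (mtopology M) B" "x \<in> A" "y \<in> B" "disjnt A B"
    using M \<open>x \<noteq> y\<close> unfolding smooth_manifold_def Hausdorff_space_def by blast
  note ca = smooth_manifold_continuous_atlas[OF M]
  have "near (prod_chart c d) (x, y) (\<lambda>z. fst z \<in> A \<and> snd z \<in> B)"
    by (intro near_prod near_openin[OF ca] cd AB)
  then show ?thesis
    by (rule near_mono) (use AB(5) in \<open>auto simp: disjnt_def\<close>)
qed

section \<open>Curves, velocities and tangent spaces of retracts\<close>

lemma chart_at_in:
  assumes "x \<in> mcarrier M"
  shows "chart_at M x \<in> M" "x \<in> fst (chart_at M x)"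
proof -
  have "\<exists>c. c \<in> M \<and> x \<in> fst c" using assms by (auto simp: mcarrier_def)
  from someI_ex[OF this] show "chart_at M x \<in> M" "x \<in> fst (chart_at M x)"
    by (auto simp: chart_at_def)
qed

lemma near_curve:
  assumes c: "is_chart c" and "\<forall>\<^sub>F t in nhds 0. \<gamma> t \<in> fst c"
    and "isCont (snd c \<circ> \<gamma>) 0" and "near c (\<gamma> 0) Q"
  shows "\<forall>\<^sub>F t in nhds (0::real). Q (\<gamma> t)"
proof -
  have "((snd c \<circ> \<gamma>) \<longlongrightarrow> (snd c \<circ> \<gamma>) 0) (nhds 0)"
    using assms(3) tendsto_at_iff_tendsto_nhds[of "snd c \<circ> \<gamma>"] by (simp add: isCont_def)
  then have "\<forall>\<^sub>F t in nhds 0. \<exists>y\<in>fst c. (snd c \<circ> \<gamma>) t = snd c y \<and> Q y"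
    using near_eventually[OF c assms(4)] by (auto simp: filterlim_iff)
  then show ?thesis
    using assms(2)
  proof eventually_elim
    case (elim t)
    then show ?case using c by (auto simp: is_chart_def dest: inj_onD)
  qed
qed

lemma has_velocity_isCont: "has_velocity M \<gamma> v \<Longrightarrow> isCont (snd (chart_at M (\<gamma> 0)) \<circ> \<gamma>) 0"
  using has_derivative_continuous
  unfolding has_velocity_def has_vector_derivative_def by blast

lemma has_velocity_unique: "has_velocity M \<gamma> v \<Longrightarrow> has_velocity M \<gamma> w \<Longrightarrow> v = w"
  unfolding has_velocity_def using vector_derivative_unique_at by blast

lemma smooth_curve_in_eventually:
  assumes "smooth_curve_in M S \<gamma>"
  shows "\<forall>\<^sub>F t in nhds 0. \<gamma> t \<in> S \<inter> fst (chart_at M (\<gamma> 0))"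
proof -
  obtain e where e: "e > 0" "\<gamma> ` {-e<..<e} \<subseteq> S \<inter> fst (chart_at M (\<gamma> 0))"
    using assms unfolding smooth_curve_in_def by blast
  then have "\<forall>\<^sub>F t in nhds 0. t \<in> {-e<..<e}" by (intro eventually_nhds_in_open) auto
  then show ?thesis by eventually_elim (use e in auto)
qed

text \<open>Near time 0 the map \<open>\<rho>\<close> fixes a curve in \<open>S\<close> pointwise,
  so by the chain rule its derivative fixes the velocity.\<close>

lemma tangent_space_retract_fixed:
  assumes c: "is_chart c" "c = chart_at M x"
    and \<rho>: "smooth_at c c \<rho> x" "near c x (\<lambda>y. y \<in> S \<longrightarrow> \<rho> y = y)"
    and v: "v \<in> tangent_space M S x"
  shows "coord_deriv c c \<rho> x v = v"
proof -
  obtain \<gamma> where \<gamma>: "smooth_curve_in M S \<gamma>" "\<gamma> 0 = x" "has_velocity M \<gamma> v"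
    using v by (auto simp: tangent_space_def)
  have der: "((snd c \<circ> \<gamma>) has_vector_derivative v) (at 0)"
    using \<gamma> c(2) by (simp add: has_velocity_def)
  have ev: "\<forall>\<^sub>F t in nhds 0. \<gamma> t \<in> S \<inter> fst c"
    using smooth_curve_in_eventually[OF \<gamma>(1)] \<gamma>(2) c(2) by simp
  have "\<forall>\<^sub>F t in nhds 0. \<gamma> t \<in> S \<longrightarrow> \<rho> (\<gamma> t) = \<gamma> t"
    by (rule near_curve[OF c(1)])
       (use ev \<rho>(2) \<gamma>(2) c(2) has_velocity_isCont[OF \<gamma>(3)] in \<open>auto elim: eventually_mono\<close>)
  then have ev2: "\<forall>\<^sub>F t in nhds 0. coord_rep c c \<rho> ((snd c \<circ> \<gamma>) t) = (snd c \<circ> \<gamma>) t"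
    using ev by eventually_elim (use c(1) in auto)
  have "((\<lambda>t. coord_rep c c \<rho> ((snd c \<circ> \<gamma>) t)) has_derivative
      (\<lambda>h. coord_deriv c c \<rho> x (h *\<^sub>R v))) (at 0)"
    using has_derivative_compose[OF der[unfolded has_vector_derivative_def]]
      coord_deriv_works[OF \<rho>(1)] \<gamma>(2) by simp
  then have "((snd c \<circ> \<gamma>) has_derivative (\<lambda>h. coord_deriv c c \<rho> x (h *\<^sub>R v))) (at 0)"
    using ev2 by (rule has_derivative_cong_nhds)
  then have "((snd c \<circ> \<gamma>) has_vector_derivative coord_deriv c c \<rho> x v) (at 0)"
    unfolding has_vector_derivative_def
    by (simp add: linear_cmul[OF linear_coord_deriv[OF \<rho>(1)]])
  then show ?thesis
    using der vector_derivative_unique_at by blast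
qed

text \<open>A set defined by curves becomes the range of a linear map: \<open>\<rho>\<close> carries
  the straight coordinate line in direction \<open>u\<close> to a curve in \<open>S\<close>, whose
  velocity is the derivative of \<open>\<rho>\<close> applied to \<open>u\<close>.\<close>

lemma tangent_space_retract:
  assumes c: "is_chart c" "c = chart_at M x" and x: "x \<in> S"
    and \<rho>: "smooth_at c c \<rho> x" "near c x (\<lambda>y. \<rho> y \<in> S)" "near c x (\<lambda>y. y \<in> S \<longrightarrow> \<rho> y = y)"
  shows "tangent_space M S x = range (coord_deriv c c \<rho> x)"
proof
  have xc: "x \<in> fst c" using \<rho>(1) by (rule smooth_at_in_chart)
  have \<rho>x: "\<rho> x = x" using near_mem[OF \<rho>(3)] x by simp
  show "tangent_space M S x \<subseteq> range (coord_deriv c c \<rho> x)"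
    using tangent_space_retract_fixed[OF c \<rho>(1,3)] by (metis rangeI subsetI)
  show "range (coord_deriv c c \<rho> x) \<subseteq> tangent_space M S x"
  proof clarify
    fix u
    obtain W where W: "W \<subseteq> fst c" "x \<in> W" "open (snd c ` W)" "\<rho> ` W \<subseteq> fst c"
      "smooth_on (coord_rep c c \<rho>) (snd c ` W)" using \<rho>(1) by (rule smooth_atE)
    obtain V where V: "V \<subseteq> fst c" "x \<in> V" "open (snd c ` V)" "\<forall>y\<in>V. \<rho> y \<in> S"
      using \<rho>(2) unfolding near_def by blast
    let ?D = "snd c ` (W \<inter> V)"
    have D: "open ?D"
      using W V by (simp add: is_chart_image_Int[OF c(1)] open_Int)
    let ?a = "\<lambda>t::real. snd c x + t *\<^sub>R u"
    define \<gamma> where "\<gamma> t = \<rho> (inv_into (fst c) (snd c) (?a t))" for t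
    have \<gamma>0: "\<gamma> 0 = x" using c(1) xc \<rho>x by (simp add: \<gamma>_def)
    have "open (?a -` ?D)"
      using D by (intro open_vimage continuous_intros)
    moreover have "0 \<in> ?a -` ?D" using W V by simp
    ultimately obtain e where e: "e > 0" "ball 0 e \<subseteq> ?a -` ?D"
      using open_contains_ball by blast
    have e': "?a ` {-e<..<e} \<subseteq> ?D" using e(2) by (auto simp: subset_iff)
    have \<gamma>D: "\<gamma> t \<in> S \<inter> fst c" if t: "?a t \<in> ?D" for t
    proof -
      obtain y where y: "y \<in> W \<inter> V" "?a t = snd c y" using t by blast
      then have "\<gamma> t = \<rho> y" using W(1) c(1) by (auto simp: \<gamma>_def)
      then show ?thesis using y W(4) V(4) by auto
    qed
    have eq: "(snd c \<circ> \<gamma>) = (\<lambda>t. coord_rep c c \<rho> (?a t))"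
      by (simp add: fun_eq_iff \<gamma>_def coord_rep_def)
    have lin: "bounded_linear (\<lambda>t::real. t *\<^sub>R u)" by (rule bounded_linear_scaleR_left)
    have "smooth_on (\<lambda>t. coord_rep c c \<rho> (?a t)) {-e<..<e}"
      by (rule smooth_on_compose[OF _ D e' smooth_on_add smooth_on_subset[OF W(5)]])
         (auto intro: smooth_on_const smooth_on_linear[OF _ lin])
    then have sm: "smooth_curve_in M S \<gamma>"
      unfolding smooth_curve_in_def \<gamma>0 c(2)[symmetric] eq
      using e(1) e' \<gamma>D by (intro exI[of _ e]) auto
    have "(?a has_derivative (\<lambda>h. h *\<^sub>R u)) (at 0)"
      by (auto intro!: derivative_eq_intros)
    then have "((\<lambda>t. coord_rep c c \<rho> (?a t)) has_derivative (\<lambda>h. coord_deriv c c \<rho> x (h *\<^sub>R u))) (at 0)"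
      by (rule has_derivative_compose) (simp add: coord_deriv_works[OF \<rho>(1)])
    then have "((snd c \<circ> \<gamma>) has_vector_derivative coord_deriv c c \<rho> x u) (at 0)"
      unfolding eq has_vector_derivative_def
      by (simp add: linear_cmul[OF linear_coord_deriv[OF \<rho>(1)]])
    moreover have "\<forall>\<^sub>F t in nhds 0. \<gamma> t \<in> fst c"
      using smooth_curve_in_eventually[OF sm] \<gamma>0 c(2) by (auto elim: eventually_mono)
    ultimately have "has_velocity M \<gamma> (coord_deriv c c \<rho> x u)"
      unfolding has_velocity_def \<gamma>0 c(2)[symmetric] by blast
    then show "coord_deriv c c \<rho> x u \<in> tangent_space M S x"
      unfolding tangent_space_def using sm \<gamma>0 by blast
  qed
qed

section \<open>Grassmannians\<close>

locale complementary_frames =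
  fixes f :: "real^'k \<Rightarrow> 'v::euclidean_space" and g :: "real^'m \<Rightarrow> 'v"
  assumes linear_f: "linear f" and linear_g: "linear g" and bij_fg: "bij (\<lambda>(x, y). f x + g y)"
begin

definition fcoord :: "'v \<Rightarrow> real^'k" where "fcoord v = fst (inv (\<lambda>(x, y). f x + g y) v)"
definition gcoord :: "'v \<Rightarrow> real^'m" where "gcoord v = snd (inv (\<lambda>(x, y). f x + g y) v)"

lemma coords_frames [simp]: "fcoord (f x + g y) = x" "gcoord (f x + g y) = y"
  using inv_f_f[OF bij_is_inj[OF bij_fg], of "(x, y)"] by (simp_all add: fcoord_def gcoord_def)

lemma frames_coords: "f (fcoord v) + g (gcoord v) = v"
  using surj_f_inv_f[OF bij_is_surj[OF bij_fg], of v]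
  by (simp add: fcoord_def gcoord_def case_prod_beta)

lemma linear_fcoord: "linear fcoord" and linear_gcoord: "linear gcoord"
proof -
  have add: "u + v = f (fcoord u + fcoord v) + g (gcoord u + gcoord v)" for u v
    by (subst (1) frames_coords[symmetric], subst (2) frames_coords[symmetric])
       (simp add: linear_add[OF linear_f] linear_add[OF linear_g])
  have scale: "r *\<^sub>R v = f (r *\<^sub>R fcoord v) + g (r *\<^sub>R gcoord v)" for r v
    by (subst (1) frames_coords[symmetric])
       (simp add: linear_cmul[OF linear_f] linear_cmul[OF linear_g] scaleR_add_right)
  show "linear fcoord" "linear gcoord"
    by (rule linearI; subst add scale; simp only: coords_frames)+
qed

text \<open>Membership as a linear equation; curves in the Grassmannian are always differentiated in
  this form.\<close>

lemma mem_graph_plane: "v \<in> graph_plane f g B \<longleftrightarrow> gcoord v = B *v fcoord v"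
proof
  assume "v \<in> graph_plane f g B"
  then show "gcoord v = B *v fcoord v" by (auto simp: graph_plane_def)
next
  assume "gcoord v = B *v fcoord v"
  then have "v = f (fcoord v) + g (B *v fcoord v)" using frames_coords[of v] by simp
  then show "v \<in> graph_plane f g B" unfolding graph_plane_def by blast
qed

lemma frame_in_graph_plane: "f x + g (B *v x) \<in> graph_plane f g B"
  by (simp add: mem_graph_plane)

lemma inj_graph_plane: "inj (graph_plane f g)"
proof (rule injI)
  fix B C assume eq: "graph_plane f g B = graph_plane f g C"
  have "B *v x = C *v x" for x
    using frame_in_graph_plane[of x B] unfolding eq mem_graph_plane by simp
  then show "B = C" by (simp add: matrix_eq)
qed

lemma inv_graph_plane [simp]: "inv (graph_plane f g) (graph_plane f g B) = B"
  by (simp add: inj_graph_plane)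

lemma subspace_graph_plane: "subspace (graph_plane f g B)"
  by (rule subspaceI)
     (simp_all add: mem_graph_plane linear_0[OF linear_fcoord] linear_0[OF linear_gcoord] linear_add[OF linear_fcoord]
      linear_add[OF linear_gcoord] linear_cmul[OF linear_fcoord] linear_cmul[OF linear_gcoord]
      matrix_vector_right_distrib matrix_vector_mult_scaleR)

lemma dim_graph_plane: "dim (graph_plane f g B) = CARD('k)"
proof -
  have "linear (\<lambda>x. f x + g (B *v x))"
    by (intro linear_compose_add linear_f linear_compose[OF _ linear_g, unfolded o_def]) simp
  moreover have "inj (\<lambda>x. f x + g (B *v x))"
    by (rule injI) (metis coords_frames(1))
  ultimately show ?thesis
    unfolding graph_plane_def by (simp add: dim_image_eq)
qed

end

lemma chart_at_grassmannian:
  fixes E :: "'v::euclidean_space set"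
  assumes "E \<in> mcarrier (grassmannian :: ('v set, real^'k^'m) atlas)"
  obtains f :: "real^'k \<Rightarrow> 'v" and g :: "real^'m \<Rightarrow> 'v" and B where "complementary_frames f g"
    "chart_at (grassmannian :: ('v set, real^'k^'m) atlas) E = (range (graph_plane f g), inv (graph_plane f g))"
    "E = graph_plane f g B"
  using chart_at_in[OF assms] unfolding grassmannian_def complementary_frames_def by auto

text \<open>A frame of \<open>E\<close> and one of its orthogonal complement put \<open>E\<close> at
  the centre of a chart, as the graph of the zero matrix.\<close>

lemma mem_grassmannian:
  fixes E :: "'v::euclidean_space set"
  assumes "subspace E" "dim E = CARD('k)" "DIM('v) = CARD('k) + CARD('m)"
  shows "E \<in> mcarrier (grassmannian :: ('v set, real^'k^'m) atlas)"
proof -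
  have "\<exists>f :: real^'k \<Rightarrow> 'v. linear f \<and> range f = E \<and> inj f"
    by (rule subspace_isomorphism) (use assms in auto)
  then obtain f :: "real^'k \<Rightarrow> 'v" where f: "linear f" "range f = E" "inj f" by blast
  let ?O = "{y \<in> UNIV. \<forall>x\<in>E. orthogonal x y}"
  have O: "subspace ?O" by (simp add: subspace_orthogonal_to_vectors)
  have "dim ?O + dim E = dim (UNIV :: 'v set)"
    by (rule dim_subspace_orthogonal_to_vectors) (use assms in auto)
  then have "dim ?O = CARD('m)" using assms by simp
  then have "\<exists>g :: real^'m \<Rightarrow> 'v. linear g \<and> range g = ?O \<and> inj g"
    by (intro subspace_isomorphism O) auto
  then obtain g :: "real^'m \<Rightarrow> 'v" where g: "linear g" "range g = ?O" "inj g" by blast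
  let ?h = "\<lambda>(x, y). f x + g y"
  have linh: "linear ?h"
    by (rule linearI) (auto simp: linear_add[OF f(1)] linear_add[OF g(1)] linear_cmul[OF f(1)]
        linear_cmul[OF g(1)] scaleR_add_right)
  have "z = 0" if z: "?h z = 0" for z
  proof -
    obtain x y where xy: "z = (x, y)" by force
    have "f x = - g y" using z xy by (simp add: eq_neg_iff_add_eq_0)
    moreover have "orthogonal (f x) (g y)" using f(2) g(2) by blast
    ultimately have "g y = 0" "f x = 0" by (auto simp: orthogonal_def)
    then show ?thesis using f g xy by (simp add: linear_injective_0 zero_prod_def)
  qed
  then have inj: "inj ?h" by (simp add: linear_injective_0[OF linh])
  have "dim (range ?h) = DIM((real^'k) \<times> (real^'m))"
    using dim_image_eq[OF linh, of UNIV] inj by simp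
  then have "range ?h = UNIV"
    using assms(3) linear_subspace_image[OF linh subspace_UNIV]
    by (intro subspace_dim_equal) auto
  then have "bij ?h" using inj by (simp add: bij_def)
  moreover have "E = graph_plane f g (0 :: real^'k^'m)"
    by (simp add: graph_plane_def linear_0[OF g(1)] f(2))
  ultimately show ?thesis
    unfolding mcarrier_def grassmannian_def using f(1) g(1) by auto
qed

section \<open>Velocity of a moving plane in a graph chart\<close>

lemma bounded_bilinear_matrix_matrix_mult:
  "bounded_bilinear ((**) :: real^'n^'m \<Rightarrow> real^'k^'n \<Rightarrow> real^'k^'m)"
  unfolding bilinear_conv_bounded_bilinear[symmetric] bilinear_def
  by (auto intro!: linearI simp: matrix_add_ldistrib scalar_matrix_assoc matrix_scalar_ac)
     (simp add: matrix_matrix_mult_def vec_eq_iff sum.distrib distrib_right)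

lemma bounded_bilinear_matrix_vector_mult:
  "bounded_bilinear ((*v) :: real^'n^'m \<Rightarrow> real^'n \<Rightarrow> real^'m)"
  unfolding bilinear_conv_bounded_bilinear[symmetric] bilinear_def
  by (auto intro!: linearI simp: matrix_vector_mult_add_rdistrib scaleR_matrix_vector_assoc)

lemma has_vector_derivative_iff_tendsto:
  "(f has_vector_derivative D) (at x) \<longleftrightarrow> ((\<lambda>h. (1 / h) *\<^sub>R (f (x + h) - f x)) \<longlongrightarrow> D) (at 0)"
proof -
  have "(1 / h) *\<^sub>R (f (x + h) - f x) - D = (1 / h) *\<^sub>R (f (x + h) - f x - h *\<^sub>R D)" if "h \<noteq> 0" for h
    using that by (simp add: algebra_simps)
  then have "norm (f (x + h) - f x - h *\<^sub>R D) / norm h = norm ((1 / h) *\<^sub>R (f (x + h) - f x) - D)"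
    if "h \<noteq> 0" for h using that by simp
  then have "((\<lambda>h. norm (f (x + h) - f x - h *\<^sub>R D) / norm h) \<longlongrightarrow> 0) (at 0) \<longleftrightarrow>
      ((\<lambda>h. norm ((1 / h) *\<^sub>R (f (x + h) - f x) - D)) \<longlongrightarrow> 0) (at 0)"
    by (intro tendsto_cong) (auto simp: eventually_at_filter)
  also have "\<dots> \<longleftrightarrow> ((\<lambda>h. (1 / h) *\<^sub>R (f (x + h) - f x)) \<longlongrightarrow> D) (at 0)"
    by (simp add: tendsto_norm_zero_iff LIM_zero_iff)
  finally show ?thesis
    by (simp add: has_vector_derivative_def has_derivative_at bounded_linear_scaleR_left)
qed

lemma has_vector_derivative_vecI:
  fixes X :: "real \<Rightarrow> 'a::euclidean_space^'n"
  assumes "\<And>i. ((\<lambda>t. X t $ i) has_vector_derivative D $ i) (at x)"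
  shows "(X has_vector_derivative D) (at x)"
proof -
  have "((\<lambda>t. X t \<bullet> b) has_derivative (\<lambda>h. (h *\<^sub>R D) \<bullet> b)) (at x)" if Basis: "b \<in> Basis" for b
  proof -
    obtain i u where b: "b = axis i u" using Basis by (auto simp: Basis_vec_def)
    show ?thesis
      using has_derivative_inner_left[OF assms[of i, unfolded has_vector_derivative_def], of u]
      by (simp add: b inner_axis)
  qed
  then show ?thesis
    unfolding has_vector_derivative_def has_derivative_componentwise_within[of X] by blast
qed

lemma has_vector_derivative_matrix:
  fixes A :: "real \<Rightarrow> real^'n \<Rightarrow> real^'m"
  assumes "\<And>v. ((\<lambda>t. A t v) has_vector_derivative A' v) (at x)"
  shows "((\<lambda>t. matrix (A t)) has_vector_derivative matrix A') (at x)"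
  unfolding matrix_def
  by (intro has_vector_derivative_vecI)
     (simp add: bounded_linear.has_vector_derivative[OF bounded_linear_vec_nth assms])

text \<open>
  The difference quotients \<open>q\<close> of \<open>B\<close> satisfy \<open>q t ** a t \<longlongrightarrow> y\<close> with \<open>a t \<longlongrightarrow> mat 1\<close>. This
  bounds \<open>q\<close>, hence \<open>q t - q t ** a t \<longlongrightarrow> 0\<close>.
\<close>

lemma has_vector_derivative_matrix_quotient:
  fixes a :: "real \<Rightarrow> real^'k^'k" and b B :: "real \<Rightarrow> real^'k^'m"
  assumes a: "(a has_vector_derivative a') (at 0)" "a 0 = mat 1"
    and b: "(b has_vector_derivative b') (at 0)"
    and B: "\<forall>\<^sub>F t in nhds 0. B t ** a t = b t"
  shows "(B has_vector_derivative (b' - B 0 ** a')) (at 0)"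
proof -
  interpret bounded_bilinear "(**) :: real^'k^'m \<Rightarrow> real^'k^'k \<Rightarrow> real^'k^'m"
    by (rule bounded_bilinear_matrix_matrix_mult)
  obtain K where K: "K > 0" "\<And>(X :: real^'k^'m) (Y :: real^'k^'k). norm (X ** Y) \<le> norm X * norm Y * K"
    using pos_bounded by blast
  define q where "q t = (1 / t) *\<^sub>R (B t - B 0)" for t
  \<comment> \<open>The value that the quotient rule predicts for b times the inverse of a, given
    \<open>a 0 = mat 1\<close>.\<close>
  define y where "y = b' - B 0 ** a'"
  have b0: "b 0 = B 0" using eventually_nhds_x_imp_x[OF B] a(2) by simp
  have lim: "((\<lambda>t. (1 / t) *\<^sub>R (b t - b 0) - B 0 ** ((1 / t) *\<^sub>R (a t - a 0))) \<longlongrightarrow> y) (at 0)"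
    unfolding y_def using a(1) b by (intro tendsto_intros tendsto) (simp_all add: has_vector_derivative_iff_tendsto)
  have evB: "\<forall>\<^sub>F t in at 0. B t ** a t = b t"
    using B by (simp add: eventually_at_filter eventually_mono)
  then have "\<forall>\<^sub>F t in at 0. (1 / t) *\<^sub>R (b t - b 0) - B 0 ** ((1 / t) *\<^sub>R (a t - a 0)) = q t ** a t"
    by eventually_elim
       (simp add: q_def b0 a(2) scaleR_left scaleR_right diff_left diff_right scaleR_diff_right flip: b0)
  then have z: "((\<lambda>t. q t ** a t) \<longlongrightarrow> y) (at 0)"
    using lim by (rule Lim_transform_eventually[rotated])
  have "isCont a 0"
    using a(1) has_derivative_continuous unfolding has_vector_derivative_def by blast
  then have a0: "((\<lambda>t. a t - mat 1) \<longlongrightarrow> 0) (at 0)"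
    using a(2) by (simp add: isCont_def LIM_zero_iff)
  \<comment> \<open>With \<open>K\<close> bounding the matrix product, this threshold keeps the norm
    of \<open>q t - q t ** a t\<close> below half the norm of \<open>q t\<close>, so
    \<open>q t\<close> is at most twice as large as the convergent
    \<open>q t ** a t\<close>.\<close>
  then have "\<forall>\<^sub>F t in at 0. norm (a t - mat 1) < 1 / (2 * K)"
    using K(1) by (intro order_tendstoD(2)[OF tendsto_norm_zero]) auto
  moreover have "\<forall>\<^sub>F t in at 0. norm (q t ** a t) < norm y + 1"
    by (rule order_tendstoD(2)[OF tendsto_norm[OF z]]) simp
  ultimately have "\<forall>\<^sub>F t in at 0. norm (q t - q t ** a t) \<le> (2 * (norm y + 1) * K) * norm (a t - mat 1)"
  proof eventually_elim
    case (elim t)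
    have eq: "q t - q t ** a t = - (q t ** (a t - mat 1))" by (simp add: diff_right)
    have le: "norm (q t ** (a t - mat 1)) \<le> norm (q t) * (norm (a t - mat 1) * K)"
      using K(2)[of "q t" "a t - mat 1"] by (simp add: mult.assoc)
    also have "\<dots> \<le> norm (q t) * (1 / 2)"
      using elim(1) K(1) by (intro mult_left_mono) (auto simp: field_simps)
    finally have "norm (q t - q t ** a t) \<le> norm (q t) / 2" using eq by simp
    then have "norm (q t) \<le> 2 * (norm y + 1)"
      using norm_triangle_ineq2[of "q t" "q t ** a t"] elim(2) by (simp add: field_simps)
    then have "norm (q t) * (norm (a t - mat 1) * K) \<le> (2 * (norm y + 1)) * (norm (a t - mat 1) * K)"
      using K(1) by (intro mult_right_mono) auto
    then show ?case using le eq by (simp add: mult_ac)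
  qed
  then have "((\<lambda>t. q t - q t ** a t) \<longlongrightarrow> 0) (at 0)"
    using tendsto_mult_right_zero[OF tendsto_norm_zero[OF a0]] by (rule Lim_null_comparison)
  from tendsto_add[OF this z] show ?thesis
    by (simp add: has_vector_derivative_iff_tendsto q_def y_def)
qed

context complementary_frames
begin

text \<open>Applied to the frame \<open>e\<close> of the initial plane, \<open>A t\<close> gives a
  frame of \<open>E t\<close> with coordinate matrices \<open>a t\<close> and \<open>b t\<close>.
  Since \<open>a 0\<close> is the identity, \<open>a t\<close> stays invertible, the slope of
  \<open>E t\<close> is \<open>b t\<close> times the inverse of \<open>a t\<close>, and the quotient
  rule differentiates it.\<close>

lemma graph_plane_curve_velocity:
  fixes A :: "real \<Rightarrow> 'v \<Rightarrow> 'v" and B0 :: "real^'k^'m"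
  defines "e \<equiv> \<lambda>x. f x + g (B0 *v x)"
  assumes E: "\<forall>\<^sub>F t in nhds 0. E t = range (A t) \<and> linear (A t) \<and> dim (E t) = CARD('k)"
    and E0: "E 0 = graph_plane f g B0" and A0: "\<And>v. v \<in> E 0 \<Longrightarrow> A 0 v = v"
    and A': "\<And>v. ((\<lambda>t. A t v) has_vector_derivative A' v) (at 0)"
  shows "\<forall>\<^sub>F t in nhds 0. E t \<in> range (graph_plane f g)"
    and "((\<lambda>t. inv (graph_plane f g) (E t)) has_vector_derivative
           matrix (\<lambda>x. gcoord (A' (e x))) - B0 ** matrix (\<lambda>x. fcoord (A' (e x)))) (at 0)"
proof -
  have lin_e: "linear e"
    unfolding e_def by (intro linear_compose_add linear_f linear_compose[OF _ linear_g, unfolded o_def]) simp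
  define a where "a t = matrix (\<lambda>x. fcoord (A t (e x)))" for t
  define b where "b t = matrix (\<lambda>x. gcoord (A t (e x)))" for t
  have der: "(a has_vector_derivative matrix (\<lambda>x. fcoord (A' (e x)))) (at 0)"
      "(b has_vector_derivative matrix (\<lambda>x. gcoord (A' (e x)))) (at 0)"
    unfolding a_def b_def
    by (intro has_vector_derivative_matrix bounded_linear.has_vector_derivative[OF _ A']
        linear_conv_bounded_linear[THEN iffD1] linear_fcoord linear_gcoord)+
  have "A 0 (e x) = e x" for x
    by (rule A0) (simp add: E0 e_def frame_in_graph_plane)
  then have a0: "a 0 = mat 1"
    by (simp add: a_def e_def matrix_id_mat_1[unfolded id_def])
  have "isCont a 0"
    using der(1) has_derivative_continuous unfolding has_vector_derivative_def by blast
  then have "(a \<longlongrightarrow> mat 1) (nhds 0)"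
    using a0 tendsto_at_iff_tendsto_nhds[of a 0] by (simp add: isCont_def)
  moreover have "open {X :: real^'k^'k. det X \<noteq> 0}"
  proof -
    have "continuous_on UNIV (\<lambda>X :: real^'k^'k. det X)"
      unfolding det_def by (intro continuous_intros)
    then show ?thesis
      using open_Collect_neq[OF _ continuous_on_const[of UNIV 0]] by blast
  qed
  ultimately have "\<forall>\<^sub>F t in nhds 0. det (a t) \<noteq> 0"
    by (auto dest!: topological_tendstoD)
  with E have ev: "\<forall>\<^sub>F t in nhds 0. \<exists>C. E t = graph_plane f g C \<and> C ** a t = b t"
  proof eventually_elim
    case (elim t)
    then have lin: "linear (A t)" by simp
    obtain a' where a': "a t ** a' = mat 1" "a' ** a t = mat 1"
      using elim(2) invertible_det_nz[of "a t"] unfolding invertible_def by auto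
    define C where "C = b t ** a'"
    have C: "C ** a t = b t" by (simp add: C_def matrix_mul_assoc[symmetric] a')
    have ab: "a t *v x = fcoord (A t (e x))" "b t *v x = gcoord (A t (e x))" for x
      using linear_compose[OF linear_compose[OF lin_e lin] linear_fcoord]
        linear_compose[OF linear_compose[OF lin_e lin] linear_gcoord]
      by (simp_all add: a_def b_def o_def matrix_works)
    have "graph_plane f g C \<subseteq> E t"
    proof
      fix v assume "v \<in> graph_plane f g C"
      then have v: "gcoord v = C *v fcoord v" by (simp add: mem_graph_plane)
      let ?x = "a' *v fcoord v"
      have "fcoord (A t (e ?x)) = fcoord v" "gcoord (A t (e ?x)) = gcoord v"
        unfolding ab[symmetric] v
        by (simp_all add: matrix_vector_mul_assoc a' C_def)
      then have "A t (e ?x) = v" using frames_coords by metis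
      then show "v \<in> E t" using elim(1) by (metis rangeI)
    qed
    \<comment> \<open>One inclusion is enough, both planes having dimension
      \<open>CARD('k)\<close>.\<close>
    then have "graph_plane f g C = E t"
      using elim linear_subspace_image[OF lin subspace_UNIV]
      by (intro subspace_dim_equal subspace_graph_plane) (auto simp: dim_graph_plane)
    then show ?case using C by blast
  qed
  then show "\<forall>\<^sub>F t in nhds 0. E t \<in> range (graph_plane f g)"
    by eventually_elim auto
  from ev have "\<forall>\<^sub>F t in nhds 0. inv (graph_plane f g) (E t) ** a t = b t"
    by eventually_elim auto
  from has_vector_derivative_matrix_quotient[OF der(1) a0 der(2) this]
  show "((\<lambda>t. inv (graph_plane f g) (E t)) has_vector_derivative
           matrix (\<lambda>x. gcoord (A' (e x))) - B0 ** matrix (\<lambda>x. fcoord (A' (e x)))) (at 0)"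
    by (simp add: E0)
qed


lemma chart_has_velocity_iff:
  assumes "chart_at (grassmannian :: ('v set, real^'k^'m) atlas) (c 0) = (range (graph_plane f g), inv (graph_plane f g))"
  shows "has_velocity (grassmannian :: ('v set, real^'k^'m) atlas) c B \<longleftrightarrow>
    (\<forall>\<^sub>F t in nhds 0. c t \<in> range (graph_plane f g)) \<and>
    ((\<lambda>t. inv (graph_plane f g) (c t)) has_vector_derivative B) (at 0)"
  unfolding has_velocity_def assms by (simp add: o_def)

lemma mem_plane_curve:
  "E \<in> range (graph_plane f g) \<Longrightarrow> v \<in> E \<longleftrightarrow> gcoord v = inv (graph_plane f g) E *v fcoord v"
  by (auto simp: mem_graph_plane)

text \<open>If \<open>u\<close> lies in every plane of a curve, then slope times
  \<open>fcoord u\<close> is the constant \<open>gcoord u\<close>, and its derivative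
  vanishes.\<close>

lemma tangent_space_planes_containing:
  assumes ch: "chart_at (grassmannian :: ('v set, real^'k^'m) atlas) E = (range (graph_plane f g), inv (graph_plane f g))"
    and C: "C \<in> tangent_space (grassmannian :: ('v set, real^'k^'m) atlas) (planes_containing (grassmannian :: ('v set, real^'k^'m) atlas) l) E"
    and "u \<in> l"
  shows "C *v fcoord u = 0"
proof -
  interpret mv: bounded_bilinear "(*v) :: real^'k^'m \<Rightarrow> real^'k \<Rightarrow> real^'m"
    by (rule bounded_bilinear_matrix_vector_mult)
  let ?G = "grassmannian :: ('v set, real^'k^'m) atlas"
  obtain c where c: "smooth_curve_in ?G (planes_containing ?G l) c" "c 0 = E" "has_velocity ?G c C"
    using C by (auto simp: tangent_space_def)
  have ev: "\<forall>\<^sub>F t in nhds 0. c t \<in> range (graph_plane f g)"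
    and der: "((\<lambda>t. inv (graph_plane f g) (c t)) has_vector_derivative C) (at 0)"
    using c chart_has_velocity_iff[of c] ch by auto
  have "\<forall>\<^sub>F t in nhds 0. u \<in> c t"
    using smooth_curve_in_eventually[OF c(1)]
    by eventually_elim (use \<open>u \<in> l\<close> in \<open>auto simp: planes_containing_def\<close>)
  with ev have "\<forall>\<^sub>F t in nhds 0. inv (graph_plane f g) (c t) *v fcoord u = gcoord u"
    by eventually_elim (auto simp: mem_graph_plane)
  moreover have "((\<lambda>t. inv (graph_plane f g) (c t) *v fcoord u) has_derivative (\<lambda>h. h *\<^sub>R (C *v fcoord u))) (at 0)"
    using bounded_linear.has_vector_derivative[OF mv.bounded_linear_left der]
    by (simp add: has_vector_derivative_def)
  ultimately have "((\<lambda>t. gcoord u) has_vector_derivative (C *v fcoord u)) (at 0)"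
    unfolding has_vector_derivative_def by (rule has_derivative_cong_nhds[rotated])
  then show ?thesis
    using vector_derivative_unique_at has_vector_derivative_const by blast
qed

text \<open>Differentiating the membership equation of \<open>w t\<close> in \<open>c t\<close> when
  the slope has velocity zero leaves the equation of \<open>E\<close> itself for the derivative of
  \<open>w\<close>. So the zero tangent vector gets rank 0.\<close>

lemma grassmannian_hom_zero:
  assumes ch: "chart_at (grassmannian :: ('v set, real^'k^'m) atlas) E = (range (graph_plane f g), inv (graph_plane f g))"
  shows "grassmannian_hom (grassmannian :: ('v set, real^'k^'m) atlas) E 0 v \<subseteq> E"
proof
  interpret mv: bounded_bilinear "(*v) :: real^'k^'m \<Rightarrow> real^'k \<Rightarrow> real^'m"
    by (rule bounded_bilinear_matrix_vector_mult)
  let ?G = "grassmannian :: ('v set, real^'k^'m) atlas"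
  fix u assume "u \<in> grassmannian_hom ?G E 0 v"
  then obtain c w where c: "c 0 = E" "has_velocity ?G c 0"
    and w: "\<forall>\<^sub>F t in nhds 0. w t \<in> c t" "(w has_vector_derivative u) (at 0)"
    by (auto simp: grassmannian_hom_def)
  let ?C = "\<lambda>t. inv (graph_plane f g) (c t)"
  have ev: "\<forall>\<^sub>F t in nhds 0. c t \<in> range (graph_plane f g)"
    and der: "(?C has_vector_derivative 0) (at 0)"
    using c chart_has_velocity_iff[of c] ch by auto
  have E: "E \<in> range (graph_plane f g)" using eventually_nhds_x_imp_x[OF ev] c by simp
  have w': "((\<lambda>t. fcoord (w t)) has_vector_derivative fcoord u) (at 0)"
    "((\<lambda>t. gcoord (w t)) has_vector_derivative gcoord u) (at 0)"
    by (intro bounded_linear.has_vector_derivative[OF _ w(2)]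
        linear_conv_bounded_linear[THEN iffD1] linear_fcoord linear_gcoord)+
  have "((\<lambda>t. ?C t *v fcoord (w t)) has_derivative (\<lambda>h. h *\<^sub>R (?C 0 *v fcoord u))) (at 0)"
    using mv.FDERIV[OF der[unfolded has_vector_derivative_def] w'(1)[unfolded has_vector_derivative_def]]
    by (simp add: mv.scaleR_right mv.zero_left)
  moreover have "\<forall>\<^sub>F t in nhds 0. ?C t *v fcoord (w t) = gcoord (w t)"
    using ev w(1) by eventually_elim (auto simp: mem_graph_plane)
  ultimately have "((\<lambda>t. gcoord (w t)) has_vector_derivative (?C 0 *v fcoord u)) (at 0)"
    unfolding has_vector_derivative_def by (rule has_derivative_cong_nhds)
  then have "gcoord u = ?C 0 *v fcoord u"
    using w'(2) vector_derivative_unique_at by blast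
  then show "u \<in> E" using mem_plane_curve[OF E] c(1) by simp
qed

text \<open>\<open>coset_rank\<close> looks at the union of the cosets, so it suffices to reach each
  \<open>u\<close>: the planes of slope B0 + t B carry an explicit curve of vectors with derivative
  \<open>u\<close>.\<close>

lemma grassmannian_hom_surj:
  assumes ch: "chart_at (grassmannian :: ('v set, real^'k^'m) atlas) E = (range (graph_plane f g), inv (graph_plane f g))"
    and E: "E = graph_plane f g B0" and B: "surj ((*v) B)"
  shows "(\<Union>v\<in>E. grassmannian_hom (grassmannian :: ('v set, real^'k^'m) atlas) E B v) = UNIV"
proof -
  interpret mv: bounded_bilinear "(*v) :: real^'k^'m \<Rightarrow> real^'k \<Rightarrow> real^'m"
    by (rule bounded_bilinear_matrix_vector_mult)
  let ?G = "grassmannian :: ('v set, real^'k^'m) atlas"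
  have "\<exists>v\<in>E. u \<in> grassmannian_hom ?G E B v" for u
  proof -
    \<comment> \<open>The derivative of \<open>?w\<close> below has \<open>gcoord\<close> equal to
      \<open>B0 *v fcoord u + B *v x0\<close>; this \<open>x0\<close> makes it
      \<open>gcoord u\<close>.\<close>
    obtain x0 where x0: "gcoord u - B0 *v fcoord u = B *v x0" using B by (metis surjD)
    let ?x = "\<lambda>t::real. x0 + t *\<^sub>R fcoord u" and ?C = "\<lambda>t::real. B0 + t *\<^sub>R B"
    let ?w = "\<lambda>t. f (?x t) + g (?C t *v ?x t)"
    have C: "(?C has_vector_derivative B) (at 0)" and x: "(?x has_vector_derivative fcoord u) (at 0)"
      by (auto intro!: derivative_eq_intros)
    have "((\<lambda>t. ?C t *v ?x t) has_vector_derivative (B0 *v fcoord u + B *v x0)) (at 0)"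
      using mv.has_vector_derivative[OF C x] by simp
    then have "((\<lambda>t. ?C t *v ?x t) has_vector_derivative gcoord u) (at 0)"
      using x0 by (simp add: algebra_simps)
    then have "(?w has_vector_derivative (f (fcoord u) + g (gcoord u))) (at 0)"
      by (intro has_vector_derivative_add bounded_linear.has_vector_derivative[OF _ x]
        bounded_linear.has_vector_derivative[of g] linear_conv_bounded_linear[THEN iffD1] linear_f linear_g)
    then have "(?w has_vector_derivative u) (at 0)" by (simp add: frames_coords)
    moreover have "has_velocity ?G (\<lambda>t. graph_plane f g (?C t)) B"
      using C ch E by (subst chart_has_velocity_iff) auto
    moreover have "\<forall>\<^sub>F t in nhds 0. ?w t \<in> graph_plane f g (?C t)"
      by (simp add: frame_in_graph_plane)
    ultimately have "u \<in> grassmannian_hom ?G E B (?w 0)"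
      unfolding grassmannian_hom_def
      by (auto intro!: exI[of _ "\<lambda>t. graph_plane f g (?C t)"] exI[of _ ?w] simp: E)
    moreover have "?w 0 \<in> E" by (simp add: E frame_in_graph_plane)
    ultimately show ?thesis by blast
  qed
  then show ?thesis by auto
qed

end

section \<open>Smooth incidence geometries\<close>

lemma join_converse: "join A (F\<inverse>) = meet A F"
  by (simp add: join_def meet_def fun_eq_iff)

lemma meet_converse: "meet A (F\<inverse>) = join A F"
  by (simp add: join_def meet_def fun_eq_iff)

lemma points_on_converse: "points_on (F\<inverse>) = lines_through F"
  by (simp add: points_on_def lines_through_def fun_eq_iff)

text \<open>
  Three points on each line and three lines through each point replace the four point axiom, which
  is not visibly self-dual.
\<close>

locale smooth_incidence =
  fixes P :: "('p, 'e::euclidean_space) atlas" and L :: "('l, 'e) atlas" and F :: "('p \<times> 'l) set"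
  assumes incidence_subset: "F \<subseteq> mcarrier P \<times> mcarrier L"
    and join_ex1: "\<And>p q. p \<in> mcarrier P \<Longrightarrow> q \<in> mcarrier P \<Longrightarrow> p \<noteq> q \<Longrightarrow>
      \<exists>!l. l \<in> mcarrier L \<and> (p, l) \<in> F \<and> (q, l) \<in> F"
    and meet_ex1: "\<And>l m. l \<in> mcarrier L \<Longrightarrow> m \<in> mcarrier L \<Longrightarrow> l \<noteq> m \<Longrightarrow>
      \<exists>!p. p \<in> mcarrier P \<and> (p, l) \<in> F \<and> (p, m) \<in> F"
    and manifold_P: "smooth_manifold P" and manifold_L: "smooth_manifold L"
    and smooth_join: "smooth_map_on (prod_atlas P P) L {(p, q). p \<in> mcarrier P \<and> q \<in> mcarrier P \<and> p \<noteq> q}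
       (\<lambda>(p, q). join (mcarrier L) F p q)"
    and smooth_meet: "smooth_map_on (prod_atlas L L) P {(l, m). l \<in> mcarrier L \<and> m \<in> mcarrier L \<and> l \<noteq> m}
       (\<lambda>(l, m). meet (mcarrier P) F l m)"
    and three_points: "\<And>l. l \<in> mcarrier L \<Longrightarrow> \<exists>a b c. a \<noteq> b \<and> b \<noteq> c \<and> a \<noteq> c \<and> (a, l) \<in> F \<and> (b, l) \<in> F \<and> (c, l) \<in> F"
    and three_lines: "\<And>p. p \<in> mcarrier P \<Longrightarrow> \<exists>a b c. a \<noteq> b \<and> b \<noteq> c \<and> a \<noteq> c \<and> (p, a) \<in> F \<and> (p, b) \<in> F \<and> (p, c) \<in> F"
begin

lemma dual: "smooth_incidence L P (F\<inverse>)"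
  using incidence_subset join_ex1 meet_ex1 manifold_P manifold_L smooth_join smooth_meet
    three_points three_lines
  unfolding smooth_incidence_def join_converse meet_converse by auto

abbreviation jn where "jn \<equiv> join (mcarrier L) F"
abbreviation mt where "mt \<equiv> meet (mcarrier P) F"

lemma incidence_carrier: "(p, l) \<in> F \<Longrightarrow> p \<in> mcarrier P" "(p, l) \<in> F \<Longrightarrow> l \<in> mcarrier L"
  using incidence_subset by auto

lemmas chart_P = smooth_manifold_is_chart[OF manifold_P]
lemmas chart_L = smooth_manifold_is_chart[OF manifold_L]

lemma join_incident:
  assumes "p \<in> mcarrier P" "q \<in> mcarrier P" "p \<noteq> q"
  shows "(p, jn p q) \<in> F" "(q, jn p q) \<in> F"
  using theI'[OF join_ex1[OF assms]] by (simp_all add: join_def)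

lemma join_eq: "(p, l) \<in> F \<Longrightarrow> (q, l) \<in> F \<Longrightarrow> p \<noteq> q \<Longrightarrow> jn p q = l"
  unfolding join_def using join_ex1[of p q] incidence_carrier by (intro the1_equality) auto

text \<open>The join is smooth on pairs of distinct points; the Hausdorff property makes this an
  open condition, so smoothness holds near \<open>(f x, g x)\<close> in product charts and composes
  with the pair of maps.\<close>

lemma smooth_at_join:
  assumes c: "is_chart c" and d: "d \<in> P" "d' \<in> P" "e \<in> L"
    and f: "smooth_at c d f x" "smooth_at c d' g x" and "f x \<noteq> g x" "jn (f x) (g x) \<in> fst e"
  shows "smooth_at c e (\<lambda>y. jn (f y) (g y)) x"
proof -
  have fg: "f x \<in> fst d" "g x \<in> fst d'" using f by (auto dest: smooth_at_in_chart)
  have "near (prod_chart d d') (f x, g x) (\<lambda>z. fst z \<in> fst d \<and> snd z \<in> fst d')"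
    by (intro near_prod near_self chart_P d fg)
  then have "near (prod_chart d d') (f x, g x)
      (\<lambda>z. (fst z \<in> fst d \<and> snd z \<in> fst d') \<and> fst z \<noteq> snd z)"
    by (rule near_conj[OF is_chart_prod[OF chart_P[OF d(1)] chart_P[OF d(2)]] _
          near_neq[OF manifold_P d(1,2) fg \<open>f x \<noteq> g x\<close>]])
  then have near: "near (prod_chart d d') (f x, g x)
      (\<lambda>z. z \<in> {(p, q). p \<in> mcarrier P \<and> q \<in> mcarrier P \<and> p \<noteq> q})"
    by (rule near_mono) (use d in \<open>auto simp: mcarrier_def\<close>)
  have "smooth_at (prod_chart d d') e (\<lambda>(p, q). jn p q) (f x, g x)"
    using d assms(8)
    by (intro smooth_map_on_smooth_at[OF _ smooth_join _ _ near] continuous_atlas_prod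
        smooth_manifold_continuous_atlas manifold_P) (simp_all, unfold prod_atlas_eq, blast)
  from smooth_at_compose[OF c is_chart_prod[OF chart_P[OF d(1)] chart_P[OF d(2)]]
      smooth_at_Pair[OF c f] this]
  show ?thesis by simp
qed

lemma near_neq_points:
  assumes c: "is_chart c" and d: "d \<in> P" "d' \<in> P"
    and f: "smooth_at c d f x" "smooth_at c d' g x" and "f x \<noteq> g x"
  shows "near c x (\<lambda>y. f y \<noteq> g y)"
proof -
  have fg: "f x \<in> fst d" "g x \<in> fst d'" using f by (auto dest: smooth_at_in_chart)
  from near_compose[OF c is_chart_prod[OF chart_P[OF d(1)] chart_P[OF d(2)]]
      smooth_at_Pair[OF c f] near_neq[OF manifold_P d fg \<open>f x \<noteq> g x\<close>]]
  show ?thesis by simp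
qed

end

context smooth_incidence
begin

text \<open>Meets are joins of the dual geometry, so the facts on meets and lines are those just
  proved for joins and points.\<close>

interpretation dual: smooth_incidence L P "F\<inverse>"
  by (rule dual)

lemmas meet_incident = dual.join_incident[unfolded join_converse converse_iff]
lemmas meet_eq = dual.join_eq[unfolded join_converse converse_iff]
lemmas smooth_at_meet = dual.smooth_at_join[unfolded join_converse]
lemmas near_neq_lines = dual.near_neq_points

lemma other_point:
  assumes "(p, l) \<in> F"
  obtains q where "(q, l) \<in> F" "q \<noteq> p"
  using three_points[OF incidence_carrier(2)[OF assms]] by metis

lemma other_line:
  assumes "(p, l) \<in> F"
  obtains m where "(p, m) \<in> F" "m \<noteq> l"
  using three_lines[OF incidence_carrier(1)[OF assms]] by metis

text \<open>A second point of a second line through \<open>p\<close> will do: were it on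
  \<open>l\<close>, both lines would join it to \<open>p\<close>.\<close>

lemma point_off_line:
  assumes "(p, l) \<in> F"
  obtains q where "q \<in> mcarrier P" "q \<noteq> p" "(q, l) \<notin> F"
proof -
  obtain m where m: "(p, m) \<in> F" "m \<noteq> l" using other_line[OF assms] .
  obtain q where q: "(q, m) \<in> F" "q \<noteq> p" using other_point[OF m(1)] .
  have "(q, l) \<notin> F" using join_eq[OF assms, of q] join_eq[OF m(1) q(1)] q(2) m(2) by auto
  then show thesis using that q incidence_carrier by blast
qed

section \<open>Central projection onto a line\<close>

abbreviation central_proj :: "'p \<Rightarrow> 'l \<Rightarrow> 'p \<Rightarrow> 'p" where
  "central_proj q l x \<equiv> mt l (jn x q)"

lemma central_proj_on:
  assumes "x \<in> mcarrier P" "q \<in> mcarrier P" "x \<noteq> q" "l \<in> mcarrier L" "l \<noteq> jn x q"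
  shows "(central_proj q l x, l) \<in> F" "(central_proj q l x, jn x q) \<in> F"
  using meet_incident[of l "jn x q"] join_incident[of x q] incidence_carrier assms by blast+

lemma central_proj_fixed:
  assumes "(x, l) \<in> F" "q \<in> mcarrier P" "x \<noteq> q" "l \<noteq> jn x q"
  shows "central_proj q l x = x"
  using meet_eq[of x l "jn x q"] join_incident[of x q] incidence_carrier assms by blast

lemma off_line_neq_join: "(q, l) \<notin> F \<Longrightarrow> x \<in> mcarrier P \<Longrightarrow> q \<in> mcarrier P \<Longrightarrow> x \<noteq> q \<Longrightarrow> l \<noteq> jn x q"
  using join_incident by blast

lemma smooth_at_const_point: "is_chart c \<Longrightarrow> x \<in> fst c \<Longrightarrow> q \<in> mcarrier P \<Longrightarrow> smooth_at c (chart_at P q) (\<lambda>_. q) x"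
  by (intro smooth_at_const chart_at_in)

lemma smooth_at_const_line: "is_chart c \<Longrightarrow> x \<in> fst c \<Longrightarrow> l \<in> mcarrier L \<Longrightarrow> smooth_at c (chart_at L l) (\<lambda>_. l) x"
  by (intro smooth_at_const chart_at_in)

lemma smooth_at_join_const:
  assumes "is_chart c" "d \<in> P" "smooth_at c d f x" "q \<in> mcarrier P" "f x \<noteq> q"
  shows "smooth_at c (chart_at L (jn (f x) q)) (\<lambda>y. jn (f y) q) x"
proof -
  have x: "x \<in> fst c" "f x \<in> mcarrier P"
    using smooth_at_in_chart[OF assms(3)] assms(2) by (auto simp: mcarrier_def)
  have "jn (f x) q \<in> mcarrier L"
    using join_incident[OF x(2) assms(4,5)] incidence_carrier by blast
  then show ?thesis
    by (intro smooth_at_join[OF assms(1,2) _ _ assms(3) smooth_at_const_point] chart_at_in assms x)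
qed

text \<open>Smoothness jointly in line and point: fixing the line gives the retraction, and varying
  it gives the differential of the Gauss map.\<close>

lemma smooth_at_central_proj:
  assumes "cl \<in> L" "cx \<in> P" "ce \<in> P" "l \<in> fst cl" "x \<in> fst cx"
    and "q \<in> mcarrier P" "x \<noteq> q" "l \<noteq> jn x q" "central_proj q l x \<in> fst ce"
  shows "smooth_at (prod_chart cl cx) ce (\<lambda>(l, x). central_proj q l x) (l, x)"
proof -
  note ch = chart_L[OF assms(1)] chart_P[OF assms(2)]
  have z: "(l, x) \<in> fst cl \<times> fst cx" using assms by simp
  have x: "x \<in> mcarrier P" using assms(2,5) by (auto simp: mcarrier_def)
  have "jn x q \<in> mcarrier L"
    using join_incident[OF x assms(6,7)] incidence_carrier by blast
  then have "smooth_at (prod_chart cl cx) ce (\<lambda>z. mt (fst z) (jn (snd z) q)) (l, x)"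
    using smooth_at_join_const[OF is_chart_prod[OF ch] assms(2) smooth_at_snd[OF ch z] assms(6)] assms
    by (intro smooth_at_meet[OF is_chart_prod[OF ch] assms(1) _ assms(3) smooth_at_fst[OF ch z]])
       (auto simp: chart_at_in)
  then show ?thesis by (simp add: case_prod_beta')
qed

lemma near_central_proj_defined:
  assumes "cx \<in> P" "x \<in> fst cx" "q \<in> mcarrier P" "x \<noteq> q" "l \<in> mcarrier L" "l \<noteq> jn x q"
  shows "near cx x (\<lambda>y. y \<in> mcarrier P \<and> y \<noteq> q \<and> l \<noteq> jn y q)"
proof -
  note ch = chart_P[OF assms(1)]
  have x: "x \<in> mcarrier P" using assms(1,2) by (auto simp: mcarrier_def)
  have "jn x q \<in> mcarrier L"
    using join_incident[OF x assms(3,4)] incidence_carrier by blast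
  then have "near cx x (\<lambda>y. y \<noteq> q)" "near cx x (\<lambda>y. l \<noteq> jn y q)"
    using assms chart_at_in
    by (auto intro!: near_neq_points[OF ch _ _ smooth_at_id[OF ch] smooth_at_const_point[OF ch]]
      near_neq_lines[OF ch _ _ smooth_at_const_line[OF ch] smooth_at_join_const[OF ch _ smooth_at_id[OF ch]]])
  then have "near cx x (\<lambda>y. y \<noteq> q \<and> l \<noteq> jn y q)" by (intro near_conj ch)
  then show ?thesis by (rule near_mono) (use assms(1) in \<open>auto simp: mcarrier_def\<close>)
qed

text \<open>As \<open>q\<close> is off \<open>l\<close>, no line through \<open>q\<close> equals
  \<open>l\<close>, so the projection is defined at every point but \<open>q\<close>, and
  \<open>tangent_space_retract\<close> applies to it near \<open>p\<close>.\<close>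

lemma tangent_space_line:
  assumes pl: "(p, l) \<in> F" and q: "q \<in> mcarrier P" "(q, l) \<notin> F"
  defines "c \<equiv> chart_at P p"
  shows "smooth_at c c (central_proj q l) p"
    and "near c p (\<lambda>x. (central_proj q l x, l) \<in> F)"
    and "tangent_space P (points_on F l) p = range (coord_deriv c c (central_proj q l) p)"
    and "\<And>v. v \<in> tangent_space P (points_on F l) p \<Longrightarrow> coord_deriv c c (central_proj q l) p v = v"
proof -
  have P: "p \<in> mcarrier P" "l \<in> mcarrier L" using incidence_carrier pl by auto
  have c: "c \<in> P" "p \<in> fst c" unfolding c_def using chart_at_in[OF P(1)] by auto
  have cl: "chart_at L l \<in> L" "l \<in> fst (chart_at L l)" using chart_at_in[OF P(2)] by auto
  have neq: "p \<noteq> q" "l \<noteq> jn p q" using off_line_neq_join[OF q(2) P(1) q(1)] pl q by auto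
  have fix_p: "central_proj q l p = p" using central_proj_fixed pl q neq by blast
  show s: "smooth_at c c (central_proj q l) p"
    using smooth_at_central_proj[OF cl(1) c(1) c(1) cl(2) c(2) q(1) neq] fix_p c(2)
    by (intro coord_deriv_slice(1)[OF chart_L[OF cl(1)] chart_P[OF c(1)]]) simp
  note def = near_central_proj_defined[OF c q(1) neq(1) P(2) neq(2)]
  show on: "near c p (\<lambda>x. (central_proj q l x, l) \<in> F)"
    using def by (rule near_mono) (use central_proj_on q P in blast)
  have on': "near c p (\<lambda>x. central_proj q l x \<in> points_on F l)"
    using on by (simp add: points_on_def)
  have fixed: "near c p (\<lambda>x. x \<in> points_on F l \<longrightarrow> central_proj q l x = x)"
    using def by (rule near_mono) (use central_proj_fixed q P in \<open>auto simp: points_on_def\<close>)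
  have "p \<in> points_on F l" using pl by (simp add: points_on_def)
  with s on' fixed show "tangent_space P (points_on F l) p = range (coord_deriv c c (central_proj q l) p)"
    by (intro tangent_space_retract chart_P c c_def[THEN meta_eq_to_obj_eq])
  show "\<And>v. v \<in> tangent_space P (points_on F l) p \<Longrightarrow> coord_deriv c c (central_proj q l) p v = v"
    by (rule tangent_space_retract_fixed[OF chart_P[OF c(1)] c_def[THEN meta_eq_to_obj_eq] s fixed])
qed

text \<open>The first projection lands on \<open>m\<close>, which contains the second centre
  \<open>q\<close>. Projecting from there runs along \<open>m\<close> itself and hits
  \<open>l\<close> in \<open>p\<close>, so the composite is constant near \<open>p\<close>.\<close>

lemma coord_deriv_central_proj_comp:
  assumes pl: "(p, l) \<in> F" "(p, m) \<in> F" "l \<noteq> m"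
    and q: "(q, m) \<in> F" "q \<noteq> p" and q': "(q', l) \<in> F" "q' \<noteq> p"
  defines "c \<equiv> chart_at P p"
  shows "coord_deriv c c (central_proj q l) p (coord_deriv c c (central_proj q' m) p v) = 0"
proof -
  have P: "p \<in> mcarrier P" "q \<in> mcarrier P" "q' \<in> mcarrier P" using incidence_carrier pl q q' by auto
  have c: "c \<in> P" "p \<in> fst c" unfolding c_def using chart_at_in[OF P(1)] by auto
  note ch = chart_P[OF c(1)]
  have off: "(q, l) \<notin> F" "(q', m) \<notin> F"
    using join_eq[OF pl(1), of q] join_eq[OF pl(2) q(1)] join_eq[OF pl(2), of q'] join_eq[OF pl(1) q'(1)]
      q(2) q'(2) pl(3) by auto
  note l = tangent_space_line[OF pl(1) P(2) off(1), folded c_def]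
  note m = tangent_space_line[OF pl(2) P(3) off(2), folded c_def]
  have fix_p: "central_proj q' m p = p"
    using central_proj_fixed[OF pl(2) P(3)] off_line_neq_join[OF off(2) P(1,3)] q'(2) by auto
  have "near c p (\<lambda>x. central_proj q' m x \<noteq> q)"
    using near_neq_points[OF ch c(1) chart_at_in(1)[OF P(2)] m(1) smooth_at_const_point[OF ch c(2) P(2)]]
      fix_p q(2) by auto
  with m(2) have "near c p (\<lambda>x. (central_proj q' m x, m) \<in> F \<and> central_proj q' m x \<noteq> q)"
    by (rule near_conj[OF ch])
  then have "near c p (\<lambda>x. p = central_proj q l (central_proj q' m x))"
  proof (rule near_mono)
    fix x assume "(central_proj q' m x, m) \<in> F \<and> central_proj q' m x \<noteq> q"
    then have "jn (central_proj q' m x) q = m" using join_eq q(1) by blast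
    then show "p = central_proj q l (central_proj q' m x)" using meet_eq[of p l m] pl by simp
  qed
  from coord_deriv_cong[OF ch smooth_at_const[OF ch c(2) c(2)] this]
  have "coord_deriv c c (\<lambda>x. central_proj q l (central_proj q' m x)) p v = 0"
    by (simp add: coord_deriv_const)
  then show ?thesis
    using coord_deriv_compose[OF ch ch m(1), of c "central_proj q l" v] l(1) fix_p by simp
qed

text \<open>
  Near \<open>p\<close>, a point is determined by its projections to \<open>l\<close> (from a point of \<open>m\<close>) and to \<open>m\<close>
  (from a point of \<open>l\<close>), so the plane looks like the product of the two lines.
\<close>

lemma dim_tangent_space_lines:
  assumes pl: "(p, l) \<in> F" "(p, m) \<in> F" "l \<noteq> m"
  shows "dim (tangent_space P (points_on F l) p) + dim (tangent_space P (points_on F m) p) = DIM('e)"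
proof -
  define c where "c = chart_at P p"
  obtain q where q: "(q, m) \<in> F" "q \<noteq> p" using other_point[OF pl(2)] .
  obtain q' where q': "(q', l) \<in> F" "q' \<noteq> p" using other_point[OF pl(1)] .
  have P: "p \<in> mcarrier P" "q \<in> mcarrier P" "q' \<in> mcarrier P" "l \<in> mcarrier L" "m \<in> mcarrier L"
    using incidence_carrier pl q q' by auto
  have c: "c \<in> P" "p \<in> fst c" unfolding c_def using chart_at_in[OF P(1)] by auto
  note ch = chart_P[OF c(1)]
  have jq: "jn p q = m" "jn p q' = l" using join_eq pl q q' by metis+
  have off: "(q, l) \<notin> F" "(q', m) \<notin> F"
    using join_eq[OF pl(1), of q] join_eq[OF pl(2), of q'] q(2) q'(2) pl(3) jq by auto
  note l = tangent_space_line[OF pl(1) P(2) off(1), folded c_def]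
  note m = tangent_space_line[OF pl(2) P(3) off(2), folded c_def]
  let ?r = "central_proj q l" and ?s = "central_proj q' m"
  define r s where "r = coord_deriv c c ?r p" and "s = coord_deriv c c ?s p"
  have fix_p: "?r p = p" "?s p = p"
    using central_proj_fixed[OF pl(1) P(2)] central_proj_fixed[OF pl(2) P(3)] jq q(2) q'(2) pl(3) by auto
  have zero: "r (s v) = 0" "s (r v) = 0" for v
    using coord_deriv_central_proj_comp[OF pl q q', folded c_def]
      coord_deriv_central_proj_comp[OF pl(2,1) pl(3)[symmetric] q' q, folded c_def]
    by (simp_all add: r_def s_def)
  note lin = linear_coord_deriv[OF l(1), folded r_def] linear_coord_deriv[OF m(1), folded s_def]
  \<comment> \<open>The ranges of \<open>r\<close> and \<open>s\<close> are the tangent spaces, on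
    which each acts as the identity.\<close>
  have idem: "r (r v) = r v" "s (s v) = s v" for v
    unfolding r_def s_def by (simp_all only: l(3) m(3) rangeI l(4) m(4))
  \<comment> \<open>A left inverse, near \<open>p\<close>, of the pair of projections: joining each
    projected point of x to its centre gives back the projecting line through x, and the two lines
    meet in x.\<close>
  let ?\<Phi> = "\<lambda>z. mt (jn (fst z) q) (jn (snd z) q')"
  have pp: "(p, p) \<in> fst c \<times> fst c" using c by simp
  note chp = is_chart_prod[OF ch ch]
  have "smooth_at (prod_chart c c) (chart_at L m) (\<lambda>z. jn (fst z) q) (p, p)"
    "smooth_at (prod_chart c c) (chart_at L l) (\<lambda>z. jn (snd z) q') (p, p)"
    using smooth_at_join_const[OF chp c(1) smooth_at_fst[OF ch ch pp] P(2)]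
      smooth_at_join_const[OF chp c(1) smooth_at_snd[OF ch ch pp] P(3)] q(2) q'(2) jq by simp_all
  then have \<Phi>: "smooth_at (prod_chart c c) c ?\<Phi> (p, p)"
    by (rule smooth_at_meet[OF chp chart_at_in(1)[OF P(5)] chart_at_in(1)[OF P(4)] c(1)])
       (use jq pl meet_eq[of p m l] c(2) in simp_all)
  have "near c p (\<lambda>x. x \<in> mcarrier P \<and> x \<noteq> q \<and> l \<noteq> jn x q)"
    by (rule near_central_proj_defined) (use c P q(2) jq pl(3) in simp_all)
  moreover have "near c p (\<lambda>x. x \<in> mcarrier P \<and> x \<noteq> q' \<and> m \<noteq> jn x q')"
    by (rule near_central_proj_defined) (use c P q'(2) jq pl(3) in simp_all)
  moreover have "near c p (\<lambda>x. jn x q \<noteq> jn x q')"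
  proof (rule near_neq_lines[OF ch chart_at_in(1)[OF P(5)] chart_at_in(1)[OF P(4)]])
    show "smooth_at c (chart_at L m) (\<lambda>x. jn x q) p" "smooth_at c (chart_at L l) (\<lambda>x. jn x q') p"
      using smooth_at_join_const[OF ch c(1) smooth_at_id[OF ch c(2)] P(2)]
        smooth_at_join_const[OF ch c(1) smooth_at_id[OF ch c(2)] P(3)] q(2) q'(2) jq by simp_all
  qed (use jq pl(3) in simp)
  moreover have "near c p (\<lambda>x. ?r x \<noteq> q)" "near c p (\<lambda>x. ?s x \<noteq> q')"
    using near_neq_points[OF ch c(1) chart_at_in(1)[OF P(2)] l(1) smooth_at_const_point[OF ch c(2) P(2)]]
      near_neq_points[OF ch c(1) chart_at_in(1)[OF P(3)] m(1) smooth_at_const_point[OF ch c(2) P(3)]]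
      fix_p q(2) q'(2) by auto
  ultimately have "near c p (\<lambda>x. (x \<in> mcarrier P \<and> x \<noteq> q \<and> l \<noteq> jn x q) \<and>
      (x \<in> mcarrier P \<and> x \<noteq> q' \<and> m \<noteq> jn x q') \<and> jn x q \<noteq> jn x q' \<and> ?r x \<noteq> q \<and> ?s x \<noteq> q')"
    by (simp add: near_conj_iff[OF ch])
  then have near: "near c p (\<lambda>x. x = ?\<Phi> (?r x, ?s x))"
  proof (rule near_mono)
    fix x assume x: "(x \<in> mcarrier P \<and> x \<noteq> q \<and> l \<noteq> jn x q) \<and>
      (x \<in> mcarrier P \<and> x \<noteq> q' \<and> m \<noteq> jn x q') \<and> jn x q \<noteq> jn x q' \<and> ?r x \<noteq> q \<and> ?s x \<noteq> q'"
    have "jn (?r x) q = jn x q"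
      by (rule join_eq[OF central_proj_on(2)[OF _ P(2) _ P(4)] join_incident(2)[OF _ P(2)]]) (use x in auto)
    moreover have "jn (?s x) q' = jn x q'"
      by (rule join_eq[OF central_proj_on(2)[OF _ P(3) _ P(5)] join_incident(2)[OF _ P(3)]]) (use x in auto)
    moreover have "mt (jn x q) (jn x q') = x"
      by (rule meet_eq[OF join_incident(1)[OF _ P(2)] join_incident(1)[OF _ P(3)]]) (use x in auto)
    ultimately show "x = ?\<Phi> (?r x, ?s x)" by simp
  qed
  define \<psi> where "\<psi> = coord_deriv (prod_chart c c) c ?\<Phi> (p, p)"
  have lin_\<psi>: "linear \<psi>" unfolding \<psi>_def using \<Phi> by (rule linear_coord_deriv)
  have \<psi>: "\<psi> (r v, s v) = v" for v
  proof -
    have "coord_deriv c c (\<lambda>x. ?\<Phi> (?r x, ?s x)) p v = v"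
      using coord_deriv_cong[OF ch smooth_at_id[OF ch c(2)] near] coord_deriv_id[OF ch c(2)] by simp
    moreover have "coord_deriv c c (\<lambda>x. ?\<Phi> (?r x, ?s x)) p v = \<psi> (r v, s v)"
      using coord_deriv_compose[OF ch chp smooth_at_Pair[OF ch l(1) m(1)], of c ?\<Phi> v] \<Phi>
      by (simp add: fix_p coord_deriv_Pair[OF l(1) m(1)] \<psi>_def r_def s_def)
    ultimately show ?thesis by simp
  qed
  have dec: "v = r v + s v" for v
  proof -
    \<comment> \<open>What both projections miss of \<open>v\<close> is killed by \<open>r\<close>
      and \<open>s\<close>, hence zero, because \<open>\<psi>\<close> recovers a vector from its two
      images.\<close>
    let ?u = "v - (r v + s v)"
    have "r ?u = 0" "s ?u = 0"
      using lin by (simp_all add: linear_diff linear_add zero idem)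
    then have "?u = \<psi> 0" using \<psi>[of ?u] by (simp add: zero_prod_def)
    then show ?thesis using linear_0[OF lin_\<psi>] by simp
  qed
  have sub: "subspace (range r)" "subspace (range s)"
    using lin by (auto intro: linear_subspace_image)
  have "{x + y | x y. x \<in> range r \<and> y \<in> range s} = UNIV" using dec by blast
  moreover have "range r \<inter> range s = {0}"
  proof -
    have "x = 0" if "x \<in> range r" "x \<in> range s" for x
      using that idem zero by (metis imageE)
    then show ?thesis using sub by (auto simp: subspace_0)
  qed
  ultimately have "dim (range r) + dim (range s) = DIM('e)"
    using dim_sums_Int[OF sub] by simp
  then show ?thesis using l(3) m(3) by (simp add: r_def s_def)
qed

lemma tangent_space_points_on:
  assumes pl: "(p, l) \<in> F"
  shows "subspace (tangent_space P (points_on F l) p)"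
    and "2 * dim (tangent_space P (points_on F l) p) = DIM('e)"
proof -
  obtain q where q: "q \<in> mcarrier P" "(q, l) \<notin> F" using point_off_line[OF pl] .
  show "subspace (tangent_space P (points_on F l) p)"
    unfolding tangent_space_line(3)[OF pl q]
    by (intro linear_subspace_image linear_coord_deriv tangent_space_line(1)[OF pl q] subspace_UNIV)
  obtain m k where mk: "(p, m) \<in> F" "(p, k) \<in> F" "m \<noteq> l" "k \<noteq> l" "m \<noteq> k"
    using three_lines[OF incidence_carrier(1)[OF pl]] by metis
  then show "2 * dim (tangent_space P (points_on F l) p) = DIM('e)"
    using dim_tangent_space_lines[OF pl mk(1)] dim_tangent_space_lines[OF pl mk(2)]
      dim_tangent_space_lines[OF mk(1,2)] by simp
qed

end

context smooth_incidence
begin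

text \<open>Interpreted again so that the dimension count is covered as well; its dual concerns the
  tangent space of a pencil.\<close>

interpretation dual: smooth_incidence L P "F\<inverse>"
  by (rule dual)

lemmas tangent_space_lines_through = dual.tangent_space_points_on[unfolded points_on_converse converse_iff]

text \<open>One centre \<open>q\<close> serves all lines near \<open>l\<close>, and the projections
  onto lines of the pencil all fix \<open>p\<close>, so their derivatives at \<open>p\<close> act on
  one and the same coordinate space. They are partial derivatives of a map smooth in line and point
  together, hence differentiable in the line.\<close>

lemma tangent_space_line_family:
  assumes pl: "(p, l) \<in> F"
  defines "d \<equiv> chart_at L l"
  obtains A :: "'e \<Rightarrow> 'e \<Rightarrow> 'e"
  where "\<forall>v. (\<lambda>y. A y v) differentiable (at (snd d l))"
    and "near d l (\<lambda>k. (p, k) \<in> F \<longrightarrow> linear (A (snd d k)) \<and>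
      tangent_space P (points_on F k) p = range (A (snd d k)))"
    and "\<forall>v\<in>tangent_space P (points_on F l) p. A (snd d l) v = v"
proof -
  define c where "c = chart_at P p"
  have P: "p \<in> mcarrier P" "l \<in> mcarrier L" using incidence_carrier pl by auto
  have c: "c \<in> P" "p \<in> fst c" unfolding c_def using chart_at_in[OF P(1)] by auto
  have d: "d \<in> L" "l \<in> fst d" unfolding d_def using chart_at_in[OF P(2)] by auto
  note ch = chart_L[OF d(1)] chart_P[OF c(1)]
  obtain q where q: "q \<in> mcarrier P" "q \<noteq> p" "(q, l) \<notin> F" using point_off_line[OF pl] .
  let ?G = "\<lambda>(l, x). central_proj q l x"
  define A where "A y v = frechet_derivative (coord_rep (prod_chart d c) c ?G) (at (y, snd c p)) (0, v)" for y v
  have jl: "jn p q \<in> mcarrier L" "(q, jn p q) \<in> F" "(p, jn p q) \<in> F"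
    using join_incident[of p q] incidence_carrier P q by auto
  have sG: "smooth_at (prod_chart d c) c ?G (k, p)" if k: "k \<in> fst d" "(p, k) \<in> F" "k \<noteq> jn p q" for k
    using central_proj_fixed[OF k(2) q(1)] k q c by (intro smooth_at_central_proj d c) auto
  have A_eq: "A (snd d k) v = coord_deriv c c (central_proj q k) p v"
    if k: "k \<in> fst d" "(p, k) \<in> F" "k \<noteq> jn p q" for k v
    using coord_deriv_slice(2)[OF ch sG[OF k]] by (simp add: A_def coord_deriv_def)
  \<comment> \<open>Only one line of the pencil contains the centre; it is not \<open>l\<close>, so
    lines near \<open>l\<close> avoid it.\<close>
  have offk: "(q, k) \<notin> F" if "(p, k) \<in> F" "k \<noteq> jn p q" for k
    using that join_eq[OF that(1), of q] q(2) by auto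
  have A_range: "linear (A (snd d k)) \<and> tangent_space P (points_on F k) p = range (A (snd d k))"
    if k: "k \<in> fst d" "(p, k) \<in> F" "k \<noteq> jn p q" for k
  proof -
    note t = tangent_space_line[OF k(2) q(1) offk[OF k(2,3)], folded c_def]
    have "A (snd d k) = coord_deriv c c (central_proj q k) p" using A_eq[OF k] by auto
    then show ?thesis using t(3) linear_coord_deriv[OF t(1)] by simp
  qed
  have ljn: "l \<noteq> jn p q" using q(3) jl(2) by auto
  show thesis
  proof (rule that; (intro allI ballI)?)
    fix v
    obtain W where W: "(l, p) \<in> W" "smooth_on (coord_rep (prod_chart d c) c ?G) (snd (prod_chart d c) ` W)"
      using sG[OF d(2) pl ljn] by (rule smooth_atE)
    have "(snd d l, snd c p) \<in> snd (prod_chart d c) ` W" using W(1) snd_prod_chart by (metis imageI)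
    from smooth_on_frechet_derivative_differentiable[OF W(2) this]
    show "(\<lambda>y. A y v) differentiable (at (snd d l))"
      unfolding A_def by (rule differentiable_compose[of _ "\<lambda>y. (y, snd c p)"]) (simp add: differentiable_Pair)
  next
    have "near d l (\<lambda>k. k \<noteq> jn p q)"
      using near_neq_lines[OF ch(1) d(1) chart_at_in(1)[OF jl(1)] smooth_at_id[OF ch(1) d(2)]
          smooth_at_const_line[OF ch(1) d(2) jl(1)]] ljn by simp
    then show "near d l (\<lambda>k. (p, k) \<in> F \<longrightarrow> linear (A (snd d k)) \<and>
        tangent_space P (points_on F k) p = range (A (snd d k)))"
      by (rule near_mono) (use A_range in blast)
  next
    fix v assume "v \<in> tangent_space P (points_on F l) p"
    then show "A (snd d l) v = v"
      using tangent_space_line(4)[OF pl q(1,3), folded c_def] A_eq[OF d(2) pl ljn] by simp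
  qed
qed

end

section \<open>Smooth projective planes\<close>

text \<open>\<open>l\<close> contains at most two of the four points. One that is off
  \<open>l\<close> is joined to the other three by distinct lines, since no three of the four are
  collinear, and these cut \<open>l\<close> in distinct points. For the lines through
  \<open>p\<close>, the three points of some line missing \<open>p\<close> are joined to
  \<open>p\<close>.\<close>

lemma
  assumes "projective_plane P L F"
  shows projective_plane_three_points:
      "l \<in> L \<Longrightarrow> \<exists>a b c. a \<noteq> b \<and> b \<noteq> c \<and> a \<noteq> c \<and> (a, l) \<in> F \<and> (b, l) \<in> F \<and> (c, l) \<in> F"
    and projective_plane_three_lines:
      "p \<in> P \<Longrightarrow> \<exists>a b c. a \<noteq> b \<and> b \<noteq> c \<and> a \<noteq> c \<and> (p, a) \<in> F \<and> (p, b) \<in> F \<and> (p, c) \<in> F"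
proof -
  have sub: "F \<subseteq> P \<times> L"
    and ex1: "\<forall>p\<in>P. \<forall>q\<in>P. p \<noteq> q \<longrightarrow> (\<exists>!l. l \<in> L \<and> (p, l) \<in> F \<and> (q, l) \<in> F)"
    and ex1': "\<forall>l\<in>L. \<forall>m\<in>L. l \<noteq> m \<longrightarrow> (\<exists>!p. p \<in> P \<and> (p, l) \<in> F \<and> (p, m) \<in> F)"
    using assms by (simp_all add: projective_plane_def)
  have mem: "p \<in> P" "l \<in> L" if "(p, l) \<in> F" for p l using sub that by auto
  have ex_line: "\<exists>l. (p, l) \<in> F \<and> (q, l) \<in> F" if "p \<in> P" "q \<in> P" "p \<noteq> q" for p q
    using ex1 that by (meson ex1_implies_ex)
  have ex_point: "\<exists>p. (p, l) \<in> F \<and> (p, m) \<in> F" if "l \<in> L" "m \<in> L" "l \<noteq> m" for l m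
    using ex1' that by (meson ex1_implies_ex)
  have uniq: "l = m" if "(p, l) \<in> F" "(q, l) \<in> F" "(p, m) \<in> F" "(q, m) \<in> F" "p \<noteq> q" for p q l m
  proof -
    have "p \<in> P" "q \<in> P" "l \<in> L" "m \<in> L" using mem that by auto
    with ex1 \<open>p \<noteq> q\<close> have "\<exists>!l. l \<in> L \<and> (p, l) \<in> F \<and> (q, l) \<in> F" by simp
    then obtain k where "\<And>x. x \<in> L \<Longrightarrow> (p, x) \<in> F \<Longrightarrow> (q, x) \<in> F \<Longrightarrow> x = k"
      unfolding Ex1_def by auto
    from this[of l] this[of m] show ?thesis using that \<open>l \<in> L\<close> \<open>m \<in> L\<close> by simp
  qed
  have "\<exists>Q\<subseteq>P. card Q = 4 \<and> (\<forall>l\<in>L. card {q \<in> Q. (q, l) \<in> F} \<le> 2)"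
    using assms by (simp add: projective_plane_def)
  then obtain Q where Q: "Q \<subseteq> P" "card Q = 4" "\<And>l. l \<in> L \<Longrightarrow> card {q \<in> Q. (q, l) \<in> F} \<le> 2"
    by blast
  have fin: "finite Q" by (rule card_ge_0_finite) (simp add: Q(2))
  have collinear: "\<not> ((a, k) \<in> F \<and> (b, k) \<in> F \<and> (c, k) \<in> F)"
    if "{a, b, c} \<subseteq> Q" "a \<noteq> b" "b \<noteq> c" "a \<noteq> c" for a b c k
  proof
    assume k: "(a, k) \<in> F \<and> (b, k) \<in> F \<and> (c, k) \<in> F"
    have "card {a, b, c} \<le> card {q \<in> Q. (q, k) \<in> F}"
      using that k fin by (intro card_mono) auto
    moreover have "k \<in> L" using k mem(2)[of a k] by simp
    ultimately show False using Q(3)[of k] that by simp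
  qed
  have others: "\<exists>b c d. Q - {a} = {b, c, d} \<and> b \<noteq> c \<and> c \<noteq> d \<and> b \<noteq> d" if "a \<in> Q" for a
  proof -
    have "card (Q - {a}) = 3" using that Q(2) fin by simp
    then show ?thesis unfolding card_3_iff by metis
  qed
  show points: "\<exists>a b c. a \<noteq> b \<and> b \<noteq> c \<and> a \<noteq> c \<and> (a, l) \<in> F \<and> (b, l) \<in> F \<and> (c, l) \<in> F" if l: "l \<in> L" for l
  proof -
    have "\<not> Q \<subseteq> {q \<in> Q. (q, l) \<in> F}"
      using card_mono[of "{q \<in> Q. (q, l) \<in> F}" Q] Q(2) Q(3)[OF l] fin by auto
    then obtain a where a: "a \<in> Q" "(a, l) \<notin> F" by blast
    obtain b c d where bcd: "Q - {a} = {b, c, d}" "b \<noteq> c" "c \<noteq> d" "b \<noteq> d" using others[OF a(1)] by blast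
    have "\<exists>y k. (y, l) \<in> F \<and> (a, k) \<in> F \<and> (x, k) \<in> F \<and> (y, k) \<in> F" if x: "x \<in> Q - {a}" for x
    proof -
      obtain k where k: "(a, k) \<in> F" "(x, k) \<in> F" using ex_line[of a x] x a Q(1) by auto
      then obtain y where "(y, l) \<in> F" "(y, k) \<in> F" using ex_point[of l k] l a mem(2)[OF k(1)] by metis
      then show ?thesis using k by blast
    qed
    then obtain Y K where Y: "\<And>x. x \<in> Q - {a} \<Longrightarrow> (Y x, l) \<in> F \<and> (a, K x) \<in> F \<and> (x, K x) \<in> F \<and> (Y x, K x) \<in> F"
      by metis
    have "Y x \<noteq> Y z" if xz: "x \<in> Q - {a}" "z \<in> Q - {a}" "x \<noteq> z" for x z
    proof
      assume eq: "Y x = Y z"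
      have "Y x \<noteq> a" using Y[OF xz(1)] a(2) by auto
      then have "K x = K z" using uniq[of "Y x" "K x" a "K z"] Y[OF xz(1)] Y[OF xz(2)] eq by auto
      then show False using collinear[of a x z "K x"] Y[OF xz(1)] Y[OF xz(2)] xz a(1) by auto
    qed
    then have "Y b \<noteq> Y c" "Y c \<noteq> Y d" "Y b \<noteq> Y d" using bcd by auto
    moreover have "(Y b, l) \<in> F" "(Y c, l) \<in> F" "(Y d, l) \<in> F" using Y bcd(1) by auto
    ultimately show ?thesis by metis
  qed
  show "\<exists>a b c. a \<noteq> b \<and> b \<noteq> c \<and> a \<noteq> c \<and> (p, a) \<in> F \<and> (p, b) \<in> F \<and> (p, c) \<in> F" if p: "p \<in> P" for p
  proof -
    have "\<not> Q \<subseteq> {p}" using card_mono[of "{p}" Q] Q(2) by auto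
    then obtain a where a: "a \<in> Q" "a \<noteq> p" by blast
    obtain b c d where bcd: "Q - {a} = {b, c, d}" "b \<noteq> c" using others[OF a(1)] by blast
    have bc: "b \<in> Q" "c \<in> Q" "b \<noteq> a" "c \<noteq> a" using bcd by auto
    obtain k where k: "(a, k) \<in> F" "(b, k) \<in> F" using ex_line[of a b] a bc Q(1) by auto
    obtain k' where k': "(a, k') \<in> F" "(c, k') \<in> F" using ex_line[of a c] a bc Q(1) by auto
    have "k \<noteq> k'" using collinear[of a b c k] k k' bc bcd(2) a by auto
    \<comment> \<open>Two distinct lines through \<open>a\<close> share no further point, and
      \<open>p\<close> differs from \<open>a\<close>.\<close>
    then have "(p, k) \<notin> F \<or> (p, k') \<notin> F" using uniq[of p k a k'] a k k' by auto
    then obtain l where l: "l \<in> L" "(p, l) \<notin> F" using mem(2)[OF k(1)] mem(2)[OF k'(1)] by metis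
    obtain x y z where xyz: "x \<noteq> y" "y \<noteq> z" "x \<noteq> z" "(x, l) \<in> F" "(y, l) \<in> F" "(z, l) \<in> F"
      using points[OF l(1)] by metis
    have ex: "\<exists>k. (p, k) \<in> F \<and> (u, k) \<in> F" if "(u, l) \<in> F" for u
      using ex_line[of p u] p l(2) mem(1)[OF that] that by metis
    obtain k1 k2 k3 where k: "(p, k1) \<in> F" "(x, k1) \<in> F" "(p, k2) \<in> F" "(y, k2) \<in> F" "(p, k3) \<in> F" "(z, k3) \<in> F"
      using ex[OF xyz(4)] ex[OF xyz(5)] ex[OF xyz(6)] by metis
    have ne: "k \<noteq> k'" if "(p, k) \<in> F" "(u, k) \<in> F" "(u, l) \<in> F" "(w, k') \<in> F" "(w, l) \<in> F" "u \<noteq> w" for k k' u w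
      using uniq[of u k w l] that l(2) by auto
    have "k1 \<noteq> k2" "k2 \<noteq> k3" "k1 \<noteq> k3"
      using ne[OF k(1,2) xyz(4) k(4) xyz(5,1)] ne[OF k(3,4) xyz(5) k(6) xyz(6,2)] ne[OF k(1,2) xyz(4) k(6) xyz(6,3)] by auto
    then show ?thesis using k by metis
  qed
qed

lemma smooth_projective_plane_incidence:
  assumes "smooth_projective_plane P L F"
  shows "smooth_incidence P L F"
proof
  have pp: "projective_plane (mcarrier P) (mcarrier L) F"
    using assms by (simp add: smooth_projective_plane_def)
  show "\<exists>a b c. a \<noteq> b \<and> b \<noteq> c \<and> a \<noteq> c \<and> (a, l) \<in> F \<and> (b, l) \<in> F \<and> (c, l) \<in> F" if "l \<in> mcarrier L" for l
    using projective_plane_three_points[OF pp that] .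
  show "\<exists>a b c. a \<noteq> b \<and> b \<noteq> c \<and> a \<noteq> c \<and> (p, a) \<in> F \<and> (p, b) \<in> F \<and> (p, c) \<in> F" if "p \<in> mcarrier P" for p
    using projective_plane_three_lines[OF pp that] .
qed (use assms in \<open>simp_all add: smooth_projective_plane_def projective_plane_def\<close>)

section \<open>The differential of the Gauss map\<close>

lemma differential_eqI:
  assumes "v \<in> tangent_space M S x"
    and "\<And>c. smooth_curve_in M S c \<Longrightarrow> c 0 = x \<Longrightarrow> has_velocity M c v \<Longrightarrow> has_velocity N (f \<circ> c) w"
  shows "differential M S N f x v = w"
  unfolding differential_def
proof (rule the_equality)
  show "\<forall>c. smooth_curve_in M S c \<and> c 0 = x \<and> has_velocity M c v \<longrightarrow> has_velocity N (f \<circ> c) w"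
    using assms(2) by blast
  \<comment> \<open>Some curve with velocity \<open>v\<close> must exist, since otherwise every
    \<open>w'\<close> would satisfy the description.\<close>
  obtain c where "smooth_curve_in M S c" "c 0 = x" "has_velocity M c v"
    using assms(1) by (auto simp: tangent_space_def)
  then show "w' = w" if "\<forall>c. smooth_curve_in M S c \<and> c 0 = x \<and> has_velocity M c v \<longrightarrow> has_velocity N (f \<circ> c) w'" for w'
    using that assms(2) has_velocity_unique by blast
qed

lemma matrix_add_fun: "matrix (\<lambda>x. F x + G x) = matrix F + matrix G"
  by (simp add: matrix_def vec_eq_iff)

lemma matrix_scaleR_fun: "matrix (\<lambda>x. r *\<^sub>R F x) = r *\<^sub>R (matrix F :: real^'n^'m)"
  by (simp add: matrix_def vec_eq_iff)

text \<open>The velocity of the moving plane \<open>range (A y)\<close> has an explicit formula in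
  the derivative \<open>D v w\<close> of the family \<open>A\<close>, and \<open>D v w\<close> is
  linear in the velocity \<open>v\<close> of the line.\<close>

lemma gauss_differential_linear:
  fixes P :: "('p, (real^'n) \<times> (real^'n)) atlas" and L :: "('l, (real^'n) \<times> (real^'n)) atlas"
    and f g :: "real^'n \<Rightarrow> (real^'n) \<times> (real^'n)" and B0 :: "real^'n^'n"
  assumes inc: "smooth_incidence P L F" and pl: "(p, l) \<in> F"
    and fr: "complementary_frames f g"
    and ch: "chart_at half_planes (gauss P F p l) = (range (graph_plane f g), inv (graph_plane f g))"
    and B0: "gauss P F p l = graph_plane f g B0"
  obtains \<Lambda> :: "(real^'n) \<times> (real^'n) \<Rightarrow> real^'n^'n" where "linear \<Lambda>"
    "\<forall>v\<in>tangent_space L (lines_through F p) l.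
      differential L (lines_through F p) half_planes (gauss P F p) l v = \<Lambda> v"
proof -
  interpret smooth_incidence P L F by (rule inc)
  interpret complementary_frames f g by (rule fr)
  define d where "d = chart_at L l"
  obtain A where A: "\<forall>v. (\<lambda>y. A y v) differentiable (at (snd d l))"
    "near d l (\<lambda>k. (p, k) \<in> F \<longrightarrow> linear (A (snd d k)) \<and>
      tangent_space P (points_on F k) p = range (A (snd d k)))"
    "\<forall>v\<in>tangent_space P (points_on F l) p. A (snd d l) v = v"
    by (rule tangent_space_line_family[OF pl, folded d_def])
  define D where "D v w = frechet_derivative (\<lambda>y. A y w) (at (snd d l)) v" for v w
  have D: "((\<lambda>y. A y w) has_derivative (\<lambda>v. D v w)) (at (snd d l))" for w
    using spec[OF A(1), of w] unfolding D_def frechet_derivative_works .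
  note lin_D = has_derivative_linear[OF D]
  define e where "e x = f x + g (B0 *v x)" for x
  \<comment> \<open>The formula of \<open>graph_plane_curve_velocity\<close> with \<open>D v\<close>
    as the velocity of the linear maps.\<close>
  define \<Lambda> where "\<Lambda> v = matrix (\<lambda>x. gcoord (D v (e x))) - B0 ** matrix (\<lambda>x. fcoord (D v (e x)))" for v
  have D_simps: "D (v + w) u = D v u + D w u" "D (r *\<^sub>R v) u = r *\<^sub>R D v u" for v w u r
    using linear_add[OF lin_D] linear_cmul[OF lin_D] by auto
  have "linear \<Lambda>"
  proof (rule linearI)
    show "\<Lambda> (v + w) = \<Lambda> v + \<Lambda> w" for v w
      by (simp only: \<Lambda>_def D_simps linear_add[OF linear_fcoord] linear_add[OF linear_gcoord]
          matrix_add_fun matrix_add_ldistrib add_diff_add)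
    show "\<Lambda> (r *\<^sub>R v) = r *\<^sub>R \<Lambda> v" for r v
      by (simp only: \<Lambda>_def D_simps linear_cmul[OF linear_fcoord] linear_cmul[OF linear_gcoord]
          matrix_scaleR_fun matrix_scalar_ac scalar_matrix_assoc[symmetric] scaleR_diff_right)
  qed
  moreover have "differential L (lines_through F p) half_planes (gauss P F p) l v = \<Lambda> v"
    if v: "v \<in> tangent_space L (lines_through F p) l" for v
  proof (rule differential_eqI[OF v])
    fix c assume c: "smooth_curve_in L (lines_through F p) c" "c 0 = l" "has_velocity L c v"
    have d: "is_chart d" "l \<in> fst d"
      unfolding d_def using chart_at_in[OF incidence_carrier(2)[OF pl]] chart_L by simp_all
    have der: "((snd d \<circ> c) has_vector_derivative v) (at 0)"
      using c by (simp add: has_velocity_def d_def)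
    have evF: "\<forall>\<^sub>F t in nhds 0. c t \<in> lines_through F p \<inter> fst d"
      using smooth_curve_in_eventually[OF c(1)] c(2) by (simp add: d_def)
    have "\<forall>\<^sub>F t in nhds 0. (p, c t) \<in> F \<longrightarrow> linear (A (snd d (c t))) \<and>
      tangent_space P (points_on F (c t)) p = range (A (snd d (c t)))"
      by (rule near_curve[OF d(1)])
         (use evF A(2) c(2) has_velocity_isCont[OF c(3)] in \<open>auto elim: eventually_mono simp: d_def\<close>)
    with evF have E: "\<forall>\<^sub>F t in nhds 0. gauss P F p (c t) = range (A (snd d (c t))) \<and>
        linear (A (snd d (c t))) \<and> dim (gauss P F p (c t)) = CARD('n)"
    proof eventually_elim
      case (elim t)
      then have "(p, c t) \<in> F" by (simp add: lines_through_def)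
      then show ?case using elim tangent_space_points_on(2)[of p "c t"] by (simp add: gauss_def)
    qed
    have A': "((\<lambda>t. A (snd d (c t)) w) has_vector_derivative D v w) (at 0)" for w
    proof -
      have "((\<lambda>t. A ((snd d \<circ> c) t) w) has_derivative (\<lambda>h. D (h *\<^sub>R v) w)) (at 0)"
        by (rule has_derivative_compose[OF der[unfolded has_vector_derivative_def]]) (simp add: c(2) D)
      then show ?thesis by (simp add: has_vector_derivative_def linear_cmul[OF lin_D])
    qed
    have E0: "gauss P F p (c 0) = graph_plane f g B0" by (simp add: c(2) B0)
    have A0: "A (snd d (c 0)) w = w" if "w \<in> gauss P F p (c 0)" for w
      using A(3) that by (simp add: c(2) gauss_def)
    note vel = graph_plane_curve_velocity[OF E E0 A0 A', folded e_def]
    show "has_velocity half_planes (gauss P F p \<circ> c) (\<Lambda> v)"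
      using vel ch c(2) unfolding half_planes_def
      by (subst chart_has_velocity_iff) (simp_all add: \<Lambda>_def)
  qed
  ultimately show thesis using that by blast
qed

theorem lemma30:
  fixes P :: "('p, (real^'n) \<times> (real^'n)) atlas"
    and L :: "('l, (real^'n) \<times> (real^'n)) atlas"
    and F :: "('p \<times> 'l) set"
  assumes "regular_projective_plane P L F"
    and "2 * CARD('n) \<ge> 4"
  shows "plane_curves_elliptic P L F"
  unfolding plane_curves_elliptic_def
proof clarify
  fix p l A
  assume pl: "(p, l) \<in> F" and A: "A \<in> plane_curve_tableau P L F p l"
    and rank: "coset_rank (gauss P F p l) A = 1"
  have inc: "smooth_incidence P L F"
    using assms(1) smooth_projective_plane_incidence by (auto simp: regular_projective_plane_def)
  interpret smooth_incidence P L F by (rule inc)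
  define E where "E = gauss P F p l"
  define T where "T = tangent_space L (lines_through F p) l"
  have E: "subspace E" "dim E = CARD('n)"
    using tangent_space_points_on[OF pl] by (simp_all add: E_def gauss_def)
  have T: "subspace T" "dim T = CARD('n)"
    using tangent_space_lines_through[OF pl] by (simp_all add: T_def)
  have EG: "E \<in> mcarrier half_planes"
    unfolding half_planes_def using E by (intro mem_grassmannian) auto
  obtain f g :: "real^'n \<Rightarrow> (real^'n) \<times> (real^'n)" and B0 :: "real^'n^'n"
    where fr: "complementary_frames f g"
      and ch: "chart_at half_planes E = (range (graph_plane f g), inv (graph_plane f g))"
      and B0: "E = graph_plane f g B0"
    using chart_at_grassmannian[OF EG[unfolded half_planes_def]] unfolding half_planes_def by blast
  interpret complementary_frames f g by (rule fr)
  obtain \<Lambda> :: "(real^'n) \<times> (real^'n) \<Rightarrow> real^'n^'n" where \<Lambda>: "linear \<Lambda>"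
    "\<forall>v\<in>T. differential L (lines_through F p) half_planes (gauss P F p) l v = \<Lambda> v"
    by (rule gauss_differential_linear[OF inc pl fr ch[unfolded E_def] B0[unfolded E_def], folded T_def])
  obtain v where v: "v \<in> T" "A = grassmannian_hom half_planes E (\<Lambda> v)"
    using A \<Lambda>(2) unfolding plane_curve_tableau_def E_def[symmetric] T_def[symmetric] by auto
  \<comment> \<open>Parametrizing \<open>T\<close> by \<open>real^'n\<close> makes evaluation at a
    fixed vector a linear map of \<open>real^'n\<close> to itself, for which surjectivity implies
    injectivity.\<close>
  have "\<exists>h :: real^'n \<Rightarrow> (real^'n) \<times> (real^'n). linear h \<and> range h = T \<and> inj h"
    by (rule subspace_isomorphism) (use T in auto)
  then obtain h :: "real^'n \<Rightarrow> (real^'n) \<times> (real^'n)" where h: "linear h" "range h = T" by blast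
  obtain u where u: "v = h u" using v(1) h(2) by blast
  have ker: "\<Lambda> v = 0" if x0: "x0 \<noteq> 0" "\<Lambda> v *v x0 = 0" for x0
  proof -
    \<comment> \<open>The vector of \<open>E\<close> over \<open>x0\<close> in the graph chart.
      Multiplying tangent matrices by \<open>x0\<close> is evaluating them at
      \<open>w\<close>.\<close>
    define w where "w = f x0 + g (B0 *v x0)"
    have w: "w \<in> E" "fcoord w = x0" by (simp_all add: w_def B0 frame_in_graph_plane)
    then have "w \<noteq> 0" using x0(1) linear_0[OF linear_fcoord] by auto
    let ?l = "span {w}"
    have l: "subspace ?l" "dim ?l = 1" "?l \<subseteq> E"
      using \<open>w \<noteq> 0\<close> w(1) E(1) by (simp_all add: dim_span dim_singleton span_minimal)
    have "transverse L (lines_through F p) half_planes (gauss P F p) (planes_containing half_planes ?l)"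
      using assms(1) incidence_carrier(1)[OF pl] l unfolding regular_projective_plane_def by blast
    moreover have "l \<in> lines_through F p" using pl by (simp add: lines_through_def)
    moreover have "E \<in> planes_containing half_planes ?l" using EG l by (simp add: planes_containing_def)
    ultimately have tr: "{a + b | a b. a \<in> differential L (lines_through F p) half_planes (gauss P F p) l ` T \<and>
        b \<in> tangent_space half_planes (planes_containing half_planes ?l) E} = UNIV"
      unfolding transverse_def E_def T_def by blast
    have "surj (\<lambda>y. \<Lambda> (h y) *v x0)"
      unfolding surj_def
    proof
      \<comment> \<open>Transversality decomposes matrices, so \<open>z\<close> is first written as
        the value at \<open>x0\<close> of some matrix \<open>C\<close>; the summand tangent to the
        planes containing \<open>w\<close> then contributes nothing to this value.\<close>
      fix z :: "real^'n"
      obtain C :: "real^'n^'n" where C: "C *v x0 = z"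
      proof -
        obtain i where i: "x0 $ i \<noteq> 0" using x0(1) by (auto simp: vec_eq_iff)
        show thesis
        proof (rule that)
          \<comment> \<open>Column \<open>i\<close> is \<open>z\<close> divided by the nonzero entry
            of \<open>x0\<close>, and all other columns vanish.\<close>
          show "(\<chi> j k. if k = i then z $ j / x0 $ i else 0) *v x0 = z"
            using i by (simp add: matrix_vector_mult_def vec_eq_iff if_distrib[of "\<lambda>a. a * _"] cong: if_cong)
        qed
      qed
      obtain t b where tb: "t \<in> T" "C = \<Lambda> t + b"
        "b \<in> tangent_space half_planes (planes_containing half_planes ?l) E"
        using tr \<Lambda>(2) UNIV_I[of C] by (smt (verit, best) imageE mem_Collect_eq)
      have "b *v x0 = 0"
        using tangent_space_planes_containing[OF ch[unfolded half_planes_def] tb(3)[unfolded half_planes_def], of w] w(2)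
        by (simp add: span_base)
      then have "\<Lambda> t *v x0 = z" using C tb(2) by (simp add: matrix_vector_mult_add_rdistrib)
      moreover obtain y where "t = h y" using tb(1) h(2) by blast
      ultimately show "\<exists>y. z = \<Lambda> (h y) *v x0" by blast
    qed
    moreover have lin: "linear (\<lambda>y. \<Lambda> (h y) *v x0)"
      by (rule linearI)
         (simp_all add: linear_add[OF h(1)] linear_cmul[OF h(1)] linear_add[OF \<Lambda>(1)] linear_cmul[OF \<Lambda>(1)]
          matrix_vector_mult_add_rdistrib scaleR_matrix_vector_assoc)
    ultimately have "inj (\<lambda>y. \<Lambda> (h y) *v x0)" by (simp add: linear_surj_imp_inj)
    then have "u = 0" using x0(2) u by (simp add: linear_injective_0[OF lin])
    then show "\<Lambda> v = 0" using u linear_0[OF h(1)] linear_0[OF \<Lambda>(1)] by simp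
  qed
  show False
  proof (cases "\<Lambda> v = 0")
    case True
    then have "(\<Union>x\<in>E. A x) \<subseteq> E"
      using grassmannian_hom_zero[OF ch[unfolded half_planes_def]] v(2) by (auto simp: half_planes_def)
    \<comment> \<open>\<open>coset_rank\<close> subtracts natural numbers, so here it is 0.\<close>
    then have "dim (\<Union>x\<in>E. A x) \<le> dim E" by (rule dim_subset)
    then show False using rank by (simp add: coset_rank_def E_def[symmetric])
  next
    case False
    have "inj ((*v) (\<Lambda> v))"
      using ker False by (auto simp: linear_injective_0)
    then have "surj ((*v) (\<Lambda> v))" by (simp add: linear_inj_imp_surj)
    then have "(\<Union>x\<in>E. A x) = UNIV"
      using grassmannian_hom_surj[OF ch[unfolded half_planes_def] B0] v(2) by (simp add: half_planes_def)
    \<comment> \<open>The whole space has dimension 2n and \<open>E\<close> has dimension n; the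
      rank n is at least 2 by \<open>assms(2)\<close>.\<close>
    then have "coset_rank E A = CARD('n)" using E(2) by (simp add: coset_rank_def)
    then show False using rank assms(2) by (simp add: E_def)
  qed
qed

end
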